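(* Let $\alpha\in L^\infty(0,1)$ be real-valued with $0\le 2a\le\alpha(x)\le 2b<+\infty$, let $T^*T$ be any one of the self-adjoint realizations of $-\frac{d^2}{dx^2}$ listed in the context, and for $\zeta$ real near $0$ let $$Q(\zeta)=(T^*T+\zeta^2+\zeta\alpha)^{-1},\qquad R(\zeta)=-(2\zeta+\alpha)Q(\zeta),\qquad R_n(\alpha)=\frac{1}{n!}R^{(n)}(0)\quad(n=0,1,2,\dots).$$ Then $$R_n(\alpha)=-R_{n-2}(\alpha)(T^*T)^{-1}-R_{n-1}(\alpha)\,\alpha\,(T^*T)^{-1},\qquad n=2,3,\dots,$$ with $$R_0(\alpha)=R(0)=-\alpha(T^*T)^{-1},\qquad R_1(\alpha)=R'(0)=-2(T^*T)^{-1}+\alpha(T^*T)^{-1}\alpha(T^*T)^{-1}.$$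
   Context: $T^*T$ denotes one of the following operators on $L^2(0,1)$ acting by $f\mapsto -f''$, with domain consisting of all $f\in L^2(0,1)$ with $f,f'\in AC([0,1])$ (absolutely continuous), $f''\in L^2(0,1)$, and boundary conditions: (i) $T=T_{\min}$: $f(0)=f(1)=0$; (ii) $T=T_0$: $f(0)=f'(1)=0$; (iii) $T=T_1$: $f'(0)=f(1)=0$; (iv) $T=T_\omega$ for a fixed $\omega\in\mathbb{R}\setminus\{0,1\}$: $f(1)=\omega f(0)$ and $\omega f'(1)=f'(0)$. Each such $T^*T$ is self-adjoint, positive and invertible with compact inverse. A function such as $\alpha$ or $2\zeta+\alpha$ standing in an operator expression denotes the corresponding multiplication operator on $L^2(0,1)$. $R^{(n)}$ is the $n$-th derivative of $R$ with respect to $\zeta$ (in operator norm on $L^2(0,1)$). *)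

theory Defs
  imports "HOL-Analysis.Analysis"
begin

abbreviation leb01 :: "real measure" where
  "leb01 \<equiv> lebesgue_on {0<..<1}"

definition sq_integrable :: "(real \<Rightarrow> complex) \<Rightarrow> bool" where
  "sq_integrable f \<longleftrightarrow> f \<in> borel_measurable leb01 \<and> integrable leb01 (\<lambda>x. (cmod (f x))\<^sup>2)"

definition Lsq_rel :: "(real \<Rightarrow> complex) \<Rightarrow> (real \<Rightarrow> complex) \<Rightarrow> bool" where
  "Lsq_rel f g \<longleftrightarrow> sq_integrable f \<and> sq_integrable g \<and> (AE x in leb01. f x = g x)"

lemma sq_integrable_0: "sq_integrable (\<lambda>x. 0)"
  by (simp add: sq_integrable_def)

lemma sq_integrable_scaleR:
  assumes "sq_integrable f" shows "sq_integrable (\<lambda>x. c *\<^sub>R f x)"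
proof -
  have "(\<lambda>x. (cmod (c *\<^sub>R f x))\<^sup>2) = (\<lambda>x. c\<^sup>2 * (cmod (f x))\<^sup>2)"
    by (simp add: power_mult_distrib)
  moreover have "(\<lambda>x. c *\<^sub>R f x) \<in> borel_measurable leb01"
    using assms by (intro borel_measurable_scaleR) (auto simp: sq_integrable_def)
  ultimately show ?thesis using assms unfolding sq_integrable_def by simp
qed

lemma sq_integrable_add:
  assumes f: "sq_integrable f" and g: "sq_integrable g"
  shows "sq_integrable (\<lambda>x. f x + g x)"
proof -
  have [measurable]: "f \<in> borel_measurable leb01" "g \<in> borel_measurable leb01"
    using f g by (auto simp: sq_integrable_def)
  have "integrable leb01 (\<lambda>x. (cmod (f x + g x))\<^sup>2)"
  proof (rule Bochner_Integration.integrable_bound)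
    show "integrable leb01 (\<lambda>x. 2 * (cmod (f x))\<^sup>2 + 2 * (cmod (g x))\<^sup>2)"
      using f g by (simp add: sq_integrable_def)
    have "(cmod (f x + g x))\<^sup>2 \<le> 2 * (cmod (f x))\<^sup>2 + 2 * (cmod (g x))\<^sup>2" for x
    proof -
      have "(cmod (f x + g x))\<^sup>2 \<le> (cmod (f x) + cmod (g x))\<^sup>2"
        by (intro power_mono norm_triangle_ineq) auto
      also have "\<dots> \<le> 2 * (cmod (f x))\<^sup>2 + 2 * (cmod (g x))\<^sup>2"
        using sum_squares_bound[of "cmod (f x)" "cmod (g x)"] by (simp add: power2_sum)
      finally show ?thesis .
    qed
    then show "AE x in leb01. norm ((cmod (f x + g x))\<^sup>2)
        \<le> norm (2 * (cmod (f x))\<^sup>2 + 2 * (cmod (g x))\<^sup>2)"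
      by simp
  qed measurable
  then show ?thesis by (simp add: sq_integrable_def)
qed

lemma integrable_inner_sq:
  assumes f: "sq_integrable f" and g: "sq_integrable g"
  shows "integrable leb01 (\<lambda>x. f x \<bullet> g x)"
proof (rule Bochner_Integration.integrable_bound)
  have [measurable]: "f \<in> borel_measurable leb01" "g \<in> borel_measurable leb01"
    using f g by (auto simp: sq_integrable_def)
  show "integrable leb01 (\<lambda>x. (cmod (f x))\<^sup>2 + (cmod (g x))\<^sup>2)"
    using f g by (simp add: sq_integrable_def)
  show "(\<lambda>x. f x \<bullet> g x) \<in> borel_measurable leb01" by measurable
  have "\<bar>f x \<bullet> g x\<bar> \<le> (cmod (f x))\<^sup>2 + (cmod (g x))\<^sup>2" for x
  proof -
    have "\<bar>f x \<bullet> g x\<bar> \<le> cmod (f x) * cmod (g x)" by (rule Cauchy_Schwarz_ineq2)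
    also have "\<dots> \<le> 2 * cmod (f x) * cmod (g x)" by simp
    also have "\<dots> \<le> (cmod (f x))\<^sup>2 + (cmod (g x))\<^sup>2" by (rule sum_squares_bound)
    finally show ?thesis .
  qed
  then show "AE x in leb01. norm (f x \<bullet> g x) \<le> norm ((cmod (f x))\<^sup>2 + (cmod (g x))\<^sup>2)"
    by simp
qed

lemma part_equivp_Lsq_rel: "part_equivp Lsq_rel"
proof (rule part_equivpI)
  show "\<exists>f. Lsq_rel f f" using sq_integrable_0 by (auto simp: Lsq_rel_def)
  show "symp Lsq_rel" by (auto simp: symp_def Lsq_rel_def)
  show "transp Lsq_rel"
  proof (rule transpI)
    fix f g h assume fg: "Lsq_rel f g" and gh: "Lsq_rel g h"
    then have "AE x in leb01. f x = g x" "AE x in leb01. g x = h x"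
      by (auto simp: Lsq_rel_def)
    then have "AE x in leb01. f x = h x" by eventually_elim simp
    with fg gh show "Lsq_rel f h" by (simp add: Lsq_rel_def)
  qed
qed

text \<open>Elements of \<open>Lsq\<close> are a.e.-classes of complex-valued square-integrable functions on (0,1);
  \<open>toLsq f\<close> is the class of \<open>f\<close> and is meaningful only for \<open>sq_integrable f\<close>.\<close>

quotient_type Lsq = "real \<Rightarrow> complex" / partial: Lsq_rel
  morphisms rep_Lsq toLsq
  by (rule part_equivp_Lsq_rel)

text \<open>The class \<open>real_inner\<close> asks for a real inner product, here the real part of
  \<open>\<integral> cnj (f x) * g x\<close>; it induces the usual norm
  \<open>sqrt (\<integral> (cmod (f x))\<^sup>2)\<close>.\<close>

instantiation Lsq :: real_inner
begin

lift_definition zero_Lsq :: Lsq is "\<lambda>x. 0"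
  by (simp add: Lsq_rel_def sq_integrable_0)

lift_definition plus_Lsq :: "Lsq \<Rightarrow> Lsq \<Rightarrow> Lsq" is "\<lambda>f g x. f x + g x"
  by (auto simp: Lsq_rel_def sq_integrable_add)

lift_definition scaleR_Lsq :: "real \<Rightarrow> Lsq \<Rightarrow> Lsq" is "\<lambda>c f x. c *\<^sub>R f x"
  by (auto simp: Lsq_rel_def sq_integrable_scaleR)

definition uminus_Lsq :: "Lsq \<Rightarrow> Lsq" where
  "uminus_Lsq u = (-1) *\<^sub>R u"

definition minus_Lsq :: "Lsq \<Rightarrow> Lsq \<Rightarrow> Lsq" where
  "minus_Lsq u v = u + (- v)"

lift_definition inner_Lsq :: "Lsq \<Rightarrow> Lsq \<Rightarrow> real" is "\<lambda>f g. \<integral>x. f x \<bullet> g x \<partial>leb01"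
proof -
  fix f f' g g' assume "Lsq_rel f f'" "Lsq_rel g g'"
  then have [measurable]: "f \<in> borel_measurable leb01" "f' \<in> borel_measurable leb01"
      "g \<in> borel_measurable leb01" "g' \<in> borel_measurable leb01"
    and ae: "AE x in leb01. f x = f' x" "AE x in leb01. g x = g' x"
    by (auto simp: Lsq_rel_def sq_integrable_def)
  from ae have "AE x in leb01. f x \<bullet> g x = f' x \<bullet> g' x" by eventually_elim simp
  then show "(\<integral>x. f x \<bullet> g x \<partial>leb01) = (\<integral>x. f' x \<bullet> g' x \<partial>leb01)"
    by (intro integral_cong_AE) auto
qed

definition norm_Lsq :: "Lsq \<Rightarrow> real" where
  "norm_Lsq u = sqrt (u \<bullet> u)"

definition sgn_Lsq :: "Lsq \<Rightarrow> Lsq" where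
  "sgn_Lsq u = inverse (norm u) *\<^sub>R u"

definition dist_Lsq :: "Lsq \<Rightarrow> Lsq \<Rightarrow> real" where
  "dist_Lsq u v = norm (u - v)"

definition uniformity_Lsq :: "(Lsq \<times> Lsq) filter" where
  "uniformity_Lsq = (INF e\<in>{0<..}. principal {(u, v). dist u v < e})"

definition open_Lsq :: "Lsq set \<Rightarrow> bool" where
  "open_Lsq U \<longleftrightarrow> (\<forall>u\<in>U. eventually (\<lambda>(u', v). u' = u \<longrightarrow> v \<in> U) uniformity)"

instance
proof
  fix u v w :: Lsq and c d :: real
  show "u + v + w = u + (v + w)"
    by transfer (auto simp: Lsq_rel_def add.assoc intro!: sq_integrable_add)
  show "u + v = v + u"
    by transfer (auto simp: Lsq_rel_def add.commute intro!: sq_integrable_add)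
  show "0 + u = u"
    by transfer (auto simp: Lsq_rel_def)
  show "- u + u = 0"
    unfolding uminus_Lsq_def
    by transfer (auto simp: Lsq_rel_def sq_integrable_0)
  show "u - v = u + - v"
    by (rule minus_Lsq_def)
  show "c *\<^sub>R (u + v) = c *\<^sub>R u + c *\<^sub>R v"
    by transfer
      (auto simp: Lsq_rel_def scaleR_add_right intro!: sq_integrable_add sq_integrable_scaleR
            simp flip: scaleR_add_right)
  show "(c + d) *\<^sub>R u = c *\<^sub>R u + d *\<^sub>R u"
    by transfer
      (auto simp: Lsq_rel_def scaleR_add_left sq_integrable_scaleR intro!: sq_integrable_add
            simp flip: scaleR_add_left)
  show "c *\<^sub>R d *\<^sub>R u = (c * d) *\<^sub>R u"
    by transfer (auto simp: Lsq_rel_def sq_integrable_scaleR)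
  show "1 *\<^sub>R u = u"
    by transfer (auto simp: Lsq_rel_def)
  show "sgn u = inverse (norm u) *\<^sub>R u"
    by (rule sgn_Lsq_def)
  show "dist u v = norm (u - v)"
    by (rule dist_Lsq_def)
  show "uniformity = (INF e\<in>{0<..}. principal {(u, v). dist u (v::Lsq) < e})"
    by (rule uniformity_Lsq_def)
  show "open U \<longleftrightarrow> (\<forall>u\<in>U. \<forall>\<^sub>F (u', v) in uniformity. u' = u \<longrightarrow> v \<in> U)" for U :: "Lsq set"
    by (rule open_Lsq_def)
  show "u \<bullet> v = v \<bullet> u"
    by transfer (simp add: inner_commute)
  show "(u + v) \<bullet> w = u \<bullet> w + v \<bullet> w"
    by transfer (simp add: Lsq_rel_def inner_add_left integrable_inner_sq)
  show "(c *\<^sub>R u) \<bullet> v = c * (u \<bullet> v)"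
    by transfer simp
  show "0 \<le> u \<bullet> u"
    by transfer simp
  show "u \<bullet> u = 0 \<longleftrightarrow> u = 0"
  proof transfer
    fix f assume "Lsq_rel f f"
    then have f: "sq_integrable f" by (simp add: Lsq_rel_def)
    then have "(\<integral>x. f x \<bullet> f x \<partial>leb01) = 0 \<longleftrightarrow> (AE x in leb01. f x \<bullet> f x = 0)"
      by (intro integral_nonneg_eq_0_iff_AE integrable_inner_sq) auto
    with f show "(\<integral>x. f x \<bullet> f x \<partial>leb01) = 0 \<longleftrightarrow> Lsq_rel f (\<lambda>x. 0)"
      by (simp add: Lsq_rel_def sq_integrable_0)
  qed
  show "norm u = sqrt (u \<bullet> u)"
    by (rule norm_Lsq_def)
qed

end

text \<open>Operators are elements of \<open>Lsq \<Rightarrow>\<^sub>L Lsq\<close>. These are the bounded real-linear operators; those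
  occurring below are moreover complex-linear, and the operator norm is the same in both
  settings.  \<open>mult_op \<phi>\<close> is meaningful for essentially bounded measurable \<open>\<phi>\<close>, see
  \<open>mult_op_toLsq\<close>.\<close>

definition mult_op :: "(real \<Rightarrow> real) \<Rightarrow> Lsq \<Rightarrow>\<^sub>L Lsq" where
  "mult_op \<phi> = Blinfun (\<lambda>u. toLsq (\<lambda>x. \<phi> x *\<^sub>R rep_Lsq u x))"

lemma sq_integrable_mult:
  assumes \<phi> [measurable]: "\<phi> \<in> borel_measurable leb01" and B: "AE x in leb01. \<bar>\<phi> x\<bar> \<le> B"
    and f: "sq_integrable f"
  shows "sq_integrable (\<lambda>x. \<phi> x *\<^sub>R f x)"
proof -
  have [measurable]: "f \<in> borel_measurable leb01" using f by (simp add: sq_integrable_def)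
  have "integrable leb01 (\<lambda>x. (cmod (\<phi> x *\<^sub>R f x))\<^sup>2)"
  proof (rule Bochner_Integration.integrable_bound)
    show "integrable leb01 (\<lambda>x. B\<^sup>2 * (cmod (f x))\<^sup>2)" using f by (simp add: sq_integrable_def)
    show "AE x in leb01. norm ((cmod (\<phi> x *\<^sub>R f x))\<^sup>2) \<le> norm (B\<^sup>2 * (cmod (f x))\<^sup>2)"
      using B
    proof eventually_elim
      case (elim x)
      then have "(\<phi> x)\<^sup>2 \<le> B\<^sup>2" by (simp add: abs_le_square_iff[symmetric])
      then show ?case by (simp add: power_mult_distrib mult_right_mono)
    qed
  qed measurable
  then show ?thesis by (simp add: sq_integrable_def)
qed

lemma toLsq_eq: "Lsq_rel f g \<Longrightarrow> toLsq f = toLsq g"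
  using Quotient_rel_abs[OF Quotient_Lsq] by blast

lemma rep_Lsq_toLsq:
  assumes "sq_integrable f" shows "Lsq_rel (rep_Lsq (toLsq f)) f"
  using assms by (intro Quotient3_rep_abs[OF Quotient3_Lsq]) (simp add: Lsq_rel_def)

lemma sq_integrable_rep_Lsq: "sq_integrable (rep_Lsq u)"
  using Quotient_rep_reflp[OF Quotient_Lsq, of u] by (simp add: Lsq_rel_def)

lemma toLsq_rep_Lsq: "toLsq (rep_Lsq u) = u"
  by (rule Quotient_abs_rep[OF Quotient_Lsq])

lemma toLsq_add:
  "sq_integrable f \<Longrightarrow> sq_integrable g \<Longrightarrow> toLsq (\<lambda>x. f x + g x) = toLsq f + toLsq g"
  by (simp add: plus_Lsq.abs_eq Lsq_rel_def)

lemma toLsq_scaleR: "sq_integrable f \<Longrightarrow> toLsq (\<lambda>x. c *\<^sub>R f x) = c *\<^sub>R toLsq f"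
  by (simp add: scaleR_Lsq.abs_eq Lsq_rel_def)

lemma norm_toLsq:
  "sq_integrable f \<Longrightarrow> norm (toLsq f) = sqrt (\<integral>x. (cmod (f x))\<^sup>2 \<partial>leb01)"
  by (simp add: norm_Lsq_def inner_Lsq.abs_eq Lsq_rel_def power2_norm_eq_inner)

lemma mult_op_toLsq:
  assumes \<phi>: "\<phi> \<in> borel_measurable leb01" and B: "AE x in leb01. \<bar>\<phi> x\<bar> \<le> B"
    and f: "sq_integrable f"
  shows "blinfun_apply (mult_op \<phi>) (toLsq f) = toLsq (\<lambda>x. \<phi> x *\<^sub>R f x)"
proof -
  define m where "m = (\<lambda>u. toLsq (\<lambda>x. \<phi> x *\<^sub>R rep_Lsq u x))"
  have m: "m (toLsq g) = toLsq (\<lambda>x. \<phi> x *\<^sub>R g x)" if g: "sq_integrable g" for g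
    unfolding m_def
  proof (rule toLsq_eq)
    from rep_Lsq_toLsq[OF g]
    have "AE x in leb01. rep_Lsq (toLsq g) x = g x" by (simp add: Lsq_rel_def)
    then have "AE x in leb01. \<phi> x *\<^sub>R rep_Lsq (toLsq g) x = \<phi> x *\<^sub>R g x"
      by eventually_elim simp
    then show "Lsq_rel (\<lambda>x. \<phi> x *\<^sub>R rep_Lsq (toLsq g) x) (\<lambda>x. \<phi> x *\<^sub>R g x)"
      by (simp add: Lsq_rel_def sq_integrable_mult[OF \<phi> B] sq_integrable_rep_Lsq g)
  qed
  have "bounded_linear m"
  proof (rule bounded_linear_intro[where K = "\<bar>B\<bar>"])
    fix u v :: Lsq and c :: real
    obtain p q where u: "u = toLsq p" and p: "sq_integrable p"
      and v: "v = toLsq q" and q: "sq_integrable q"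
      using toLsq_rep_Lsq sq_integrable_rep_Lsq by metis
    note mp = sq_integrable_mult[OF \<phi> B p] and mq = sq_integrable_mult[OF \<phi> B q]
    show "m (u + v) = m u + m v"
      unfolding u v toLsq_add[OF p q, symmetric]
      by (simp add: m p q sq_integrable_add scaleR_add_right toLsq_add[OF mp mq, symmetric])
    show "m (c *\<^sub>R u) = c *\<^sub>R m u"
      unfolding u toLsq_scaleR[OF p, symmetric]
      by (simp add: m p sq_integrable_scaleR toLsq_scaleR[OF mp, symmetric] mult.commute)
    have "(\<integral>x. (cmod (\<phi> x *\<^sub>R p x))\<^sup>2 \<partial>leb01) \<le> (\<integral>x. B\<^sup>2 * (cmod (p x))\<^sup>2 \<partial>leb01)"
    proof (rule integral_mono_AE)
      show "integrable leb01 (\<lambda>x. (cmod (\<phi> x *\<^sub>R p x))\<^sup>2)"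
        "integrable leb01 (\<lambda>x. B\<^sup>2 * (cmod (p x))\<^sup>2)"
        using mp p by (simp_all add: sq_integrable_def)
      show "AE x in leb01. (cmod (\<phi> x *\<^sub>R p x))\<^sup>2 \<le> B\<^sup>2 * (cmod (p x))\<^sup>2"
        using B
      proof eventually_elim
        case (elim x)
        then have "(\<phi> x)\<^sup>2 \<le> B\<^sup>2" by (simp add: abs_le_square_iff[symmetric])
        then show ?case by (simp add: power_mult_distrib mult_right_mono)
      qed
    qed
    also have "\<dots> = B\<^sup>2 * (\<integral>x. (cmod (p x))\<^sup>2 \<partial>leb01)" by simp
    finally have "sqrt (\<integral>x. (cmod (\<phi> x *\<^sub>R p x))\<^sup>2 \<partial>leb01)
        \<le> sqrt (B\<^sup>2 * (\<integral>x. (cmod (p x))\<^sup>2 \<partial>leb01))"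
      by (rule real_sqrt_le_mono)
    then show "norm (m u) \<le> norm u * \<bar>B\<bar>"
      unfolding u m[OF p] norm_toLsq[OF p] norm_toLsq[OF mp] real_sqrt_mult real_sqrt_abs
      by (subst mult.commute)
  qed
  then have "blinfun_apply (mult_op \<phi>) = m"
    unfolding mult_op_def m_def[symmetric] by (rule bounded_linear_Blinfun_apply)
  with m[OF f] show ?thesis by simp
qed

definition abs_continuous_on :: "real \<Rightarrow> real \<Rightarrow> (real \<Rightarrow> complex) \<Rightarrow> bool" where
  "abs_continuous_on c d f \<longleftrightarrow>
    (\<forall>\<epsilon>>0. \<exists>\<delta>>0. \<forall>I :: (real \<times> real) set.
       finite I \<and> (\<forall>(s, t)\<in>I. c \<le> s \<and> s \<le> t \<and> t \<le> d) \<and>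
       disjoint_family_on (\<lambda>(s, t). {s<..<t}) I \<and> (\<Sum>(s, t)\<in>I. t - s) < \<delta>
       \<longrightarrow> (\<Sum>(s, t)\<in>I. cmod (f t - f s)) < \<epsilon>)"

datatype realization = Tmin | T0 | T1 | Tomega real

primrec admissible :: "realization \<Rightarrow> bool" where
  "admissible Tmin \<longleftrightarrow> True"
| "admissible T0 \<longleftrightarrow> True"
| "admissible T1 \<longleftrightarrow> True"
| "admissible (Tomega \<omega>) \<longleftrightarrow> \<omega> \<noteq> 0 \<and> \<omega> \<noteq> 1"

primrec boundary_cond :: "realization \<Rightarrow> (real \<Rightarrow> complex) \<Rightarrow> (real \<Rightarrow> complex) \<Rightarrow> bool" where
  "boundary_cond Tmin f f' \<longleftrightarrow> f 0 = 0 \<and> f 1 = 0"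
| "boundary_cond T0 f f' \<longleftrightarrow> f 0 = 0 \<and> f' 1 = 0"
| "boundary_cond T1 f f' \<longleftrightarrow> f' 0 = 0 \<and> f 1 = 0"
| "boundary_cond (Tomega \<omega>) f f' \<longleftrightarrow>
     f 1 = complex_of_real \<omega> * f 0 \<and> complex_of_real \<omega> * f' 1 = f' 0"

text \<open>Unbounded operators are represented by their graphs. \<open>TstarT K\<close> is the graph of \<open>T\<^sup>*T\<close>;
  \<open>f'\<close> is the derivative of \<open>f\<close> on [0,1] (one-sided at the end points) and \<open>f''\<close> the almost
  everywhere existing derivative of the absolutely continuous function \<open>f'\<close>.\<close>

definition TstarT :: "realization \<Rightarrow> (Lsq \<times> Lsq) set" where
  "TstarT K = {(toLsq f, toLsq (\<lambda>x. - f'' x)) | f f' f''.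
     abs_continuous_on 0 1 f \<and> abs_continuous_on 0 1 f' \<and>
     (\<forall>x\<in>{0..1}. (f has_vector_derivative f' x) (at x within {0..1})) \<and>
     (AE x in leb01. (f' has_vector_derivative f'' x) (at x)) \<and>
     sq_integrable f \<and> sq_integrable f'' \<and>
     boundary_cond K f f'}"

text \<open>The operator inverse to a graph \<open>A\<close>, as an everywhere defined bounded operator: its graph
  is the converse of \<open>A\<close>.\<close>

definition is_bounded_inverse ::
    "('a::real_normed_vector \<Rightarrow>\<^sub>L 'a) \<Rightarrow> ('a \<times> 'a) set \<Rightarrow> bool" where
  "is_bounded_inverse B A \<longleftrightarrow> (\<forall>u v. blinfun_apply B v = u \<longleftrightarrow> (u, v) \<in> A)"

definition boundedly_invertible :: "('a::real_normed_vector \<times> 'a) set \<Rightarrow> bool" where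
  "boundedly_invertible A \<longleftrightarrow> (\<exists>B. is_bounded_inverse B A)"

definition inverse_op :: "('a::real_normed_vector \<times> 'a) set \<Rightarrow> 'a \<Rightarrow>\<^sub>L 'a" where
  "inverse_op A = (THE B. is_bounded_inverse B A)"

definition pencil :: "realization \<Rightarrow> (real \<Rightarrow> real) \<Rightarrow> real \<Rightarrow> (Lsq \<times> Lsq) set" where
  "pencil K \<alpha> \<zeta> =
     {(u, w + \<zeta>\<^sup>2 *\<^sub>R u + \<zeta> *\<^sub>R blinfun_apply (mult_op \<alpha>) u) | u w. (u, w) \<in> TstarT K}"

definition Q :: "realization \<Rightarrow> (real \<Rightarrow> real) \<Rightarrow> real \<Rightarrow> Lsq \<Rightarrow>\<^sub>L Lsq" where
  "Q K \<alpha> \<zeta> = inverse_op (pencil K \<alpha> \<zeta>)"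

definition R :: "realization \<Rightarrow> (real \<Rightarrow> real) \<Rightarrow> real \<Rightarrow> Lsq \<Rightarrow>\<^sub>L Lsq" where
  "R K \<alpha> \<zeta> = - (mult_op (\<lambda>x. 2 * \<zeta> + \<alpha> x) o\<^sub>L Q K \<alpha> \<zeta>)"

definition nth_vector_derivative ::
    "nat \<Rightarrow> (real \<Rightarrow> 'a::real_normed_vector) \<Rightarrow> real \<Rightarrow> 'a" where
  "nth_vector_derivative n F = ((\<lambda>G t. vector_derivative G (at t)) ^^ n) F"

definition R_coeff :: "nat \<Rightarrow> realization \<Rightarrow> (real \<Rightarrow> real) \<Rightarrow> Lsq \<Rightarrow>\<^sub>L Lsq" where
  "R_coeff n K \<alpha> = (1 / fact n) *\<^sub>R nth_vector_derivative n (R K \<alpha>) 0"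

end

theory Submission
  imports Defs
begin

text \<open>With \<open>B = (T\<^sup>*T)\<^sup>-\<^sup>1\<close> and \<open>M\<close> the multiplication by \<open>\<alpha>\<close>, the pencil factors as
  \<open>(1 + \<zeta>\<^sup>2 B + \<zeta> M B) T\<^sup>*T\<close>, so for small \<open>\<zeta>\<close> a Neumann series gives
  \<open>R(\<zeta>) (1 + \<zeta>\<^sup>2 B + \<zeta> M B) = - (2 \<zeta> + M) B\<close>. Comparing coefficients of powers of \<open>\<zeta>\<close> is the recursion.
  Conversely, the power series whose coefficients satisfy the recursion converges near 0 and solves this
  equation, hence equals \<open>R\<close> there. The operator \<open>B\<close> is explicit: integrate twice and adjust the
  affine part to the boundary conditions.\<close>

section \<open>Completeness of \<open>L\<^sup>2\<close>\<close>

text \<open>Completeness of \<open>Lsq\<close> has to be proved because the operators on it then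
  form a Banach space, in which both the Neumann series and the power series are summed.
  \<open>TstarT\<close> is given by an epsilon-delta notion of absolute continuity and an a.e.
  derivative, so inverting it takes two real-variable theorems: a primitive is a.e. differentiable
  with the right derivative (solutions exist), and an absolutely continuous function is recovered
  from its a.e. derivative (solutions are unique). The coefficients are defined through iterated
  \<open>vector_derivative\<close>, a total function that says nothing where a derivative fails to
  exist. Differentiability of every order must therefore be established on a whole interval around
  0; equality with a power series on that interval yields it for all orders at once.\<close>

lemma obtain_toLsq:
  obtains f where "sq_integrable f" "u = toLsq f"
  using toLsq_rep_Lsq sq_integrable_rep_Lsq by metis

lemma sq_integrable_measurable: "sq_integrable f \<Longrightarrow> f \<in> borel_measurable leb01"
  by (simp add: sq_integrable_def)

lemma sq_integrable_minus: "sq_integrable f \<Longrightarrow> sq_integrable (\<lambda>x. - f x)"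
  using sq_integrable_scaleR[of f "-1"] by simp

lemma sq_integrable_diff:
  "sq_integrable f \<Longrightarrow> sq_integrable g \<Longrightarrow> sq_integrable (\<lambda>x. f x - g x)"
  using sq_integrable_add[of f "\<lambda>x. - g x"] sq_integrable_minus[of g] by simp

lemma toLsq_minus: "sq_integrable f \<Longrightarrow> toLsq (\<lambda>x. - f x) = - toLsq f"
  using toLsq_scaleR[of f "-1"] by simp

lemma toLsq_diff:
  "sq_integrable f \<Longrightarrow> sq_integrable g \<Longrightarrow> toLsq (\<lambda>x. f x - g x) = toLsq f - toLsq g"
  using toLsq_add[of f "\<lambda>x. - g x"] sq_integrable_minus[of g] toLsq_minus[of g] by simp

section \<open>Norm estimates on the unit interval\<close>

lemma nn_integral_sq_norm:
  assumes "sq_integrable f"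
  shows "(\<integral>\<^sup>+x. ennreal ((cmod (f x))\<^sup>2) \<partial>leb01) = ennreal ((norm (toLsq f))\<^sup>2)"
  using assms
  by (subst nn_integral_eq_integral) (auto simp: norm_toLsq sq_integrable_def integral_nonneg_AE)

text \<open>The nonnegative integral makes sense before integrability is known, so a bound on it
  yields integrability as a conclusion. This is the form in which Fatou's lemma delivers its
  estimate.\<close>

lemma sq_integrable_if_nn_integral_le:
  assumes [measurable]: "f \<in> borel_measurable leb01"
    and le: "(\<integral>\<^sup>+x. ennreal ((cmod (f x))\<^sup>2) \<partial>leb01) \<le> ennreal (e\<^sup>2)" and e: "0 \<le> e"
  shows "sq_integrable f" "norm (toLsq f) \<le> e"
proof -
  show f: "sq_integrable f"
    unfolding sq_integrable_def
    using le by (auto intro!: integrableI_nonneg elim: order.strict_trans1)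
  show "norm (toLsq f) \<le> e"
    using le e unfolding nn_integral_sq_norm[OF f] by (simp add: abs_le_square_iff[symmetric])
qed

lemma sq_integrable_bounded:
  assumes [measurable]: "f \<in> borel_measurable leb01"
    and C: "\<And>x. x \<in> {0<..<1} \<Longrightarrow> cmod (f x) \<le> C" and "0 \<le> C"
  shows "sq_integrable f" "norm (toLsq f) \<le> C"
proof -
  have "(\<integral>\<^sup>+x. ennreal ((cmod (f x))\<^sup>2) \<partial>leb01) \<le> (\<integral>\<^sup>+x. ennreal (C\<^sup>2) \<partial>leb01)"
    by (rule nn_integral_mono) (auto intro!: ennreal_leI power_mono C)
  also have "\<dots> = ennreal (C\<^sup>2)"
    by (simp add: emeasure_restrict_space)
  finally show "sq_integrable f" "norm (toLsq f) \<le> C"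
    using sq_integrable_if_nn_integral_le assms by blast+
qed

lemma sq_integrable_imp_integrable:
  assumes f: "sq_integrable f"
  shows "integrable leb01 f"
proof (rule Bochner_Integration.integrable_bound)
  interpret finite_measure leb01
    by (rule finite_measure_lebesgue_on) simp
  show "integrable leb01 (\<lambda>x. 1 + (cmod (f x))\<^sup>2)"
    using f by (simp add: sq_integrable_def)
  have "cmod (f x) \<le> 1 + (cmod (f x))\<^sup>2" for x
    using sum_squares_bound[of "cmod (f x)" 1] norm_ge_zero[of "f x"] by (simp del: norm_ge_zero)
  then show "AE x in leb01. norm (f x) \<le> norm (1 + (cmod (f x))\<^sup>2)"
    by simp
qed (use f in \<open>simp add: sq_integrable_def\<close>)

text \<open>Cauchy-Schwarz against the constant function 1, whose norm is at most 1. Replacing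
  \<open>f\<close> by its modulus \<open>p\<close> turns the real inner product into the wanted
  integral.\<close>

lemma integral_norm_le_norm_toLsq:
  assumes f: "sq_integrable f"
  shows "(\<integral>x. cmod (f x) \<partial>leb01) \<le> norm (toLsq f)"
proof -
  define p where "p = (\<lambda>x. complex_of_real (cmod (f x)))"
  have p: "sq_integrable p"
    using f by (auto simp: sq_integrable_def p_def)
  have one: "sq_integrable (\<lambda>x. 1)" "norm (toLsq (\<lambda>x. 1)) \<le> 1"
    using sq_integrable_bounded[of "\<lambda>x. 1" 1] by auto
  have "(\<integral>x. cmod (f x) \<partial>leb01) = toLsq p \<bullet> toLsq (\<lambda>x. 1)"
    using p one(1) by (simp add: inner_Lsq.abs_eq Lsq_rel_def) (simp add: p_def inner_complex_def)
  also have "\<dots> \<le> norm (toLsq p) * norm (toLsq (\<lambda>x. 1))"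
    by (rule norm_cauchy_schwarz)
  also have "\<dots> \<le> norm (toLsq p)"
    using one(2) by (simp add: mult_left_le)
  also have "norm (toLsq p) = norm (toLsq f)"
    using p f by (simp add: norm_toLsq) (simp add: p_def)
  finally show ?thesis .
qed

section \<open>The Riesz-Fischer theorem\<close>

lemma Cauchy_rapid_subseq:
  fixes X :: "nat \<Rightarrow> 'a::metric_space"
  assumes "Cauchy X"
  obtains r where "strict_mono r" "\<And>n. dist (X (r (Suc n))) (X (r n)) < (1/2) ^ n"
proof -
  have "\<forall>k. \<exists>N. \<forall>m\<ge>N. \<forall>n\<ge>N. dist (X m) (X n) < (1/2) ^ k"
    using assms by (auto simp: Cauchy_def)
  then obtain N where N: "\<And>k m n. m \<ge> N k \<Longrightarrow> n \<ge> N k \<Longrightarrow> dist (X m) (X n) < (1/2) ^ k"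
    by metis
  \<comment> \<open>Summing makes \<open>r n\<close> at least \<open>N n\<close>, and the
    \<open>Suc\<close> makes \<open>r\<close> strictly increasing even if some \<open>N k\<close> is
    0.\<close>
  define r where "r n = (\<Sum>k\<le>n. Suc (N k))" for n
  have r: "r (Suc n) = r n + Suc (N (Suc n))" for n
    by (simp add: r_def)
  have "N n \<le> r n" for n
    unfolding r_def using member_le_sum[of n "{..n}" "\<lambda>k. Suc (N k)"] by simp
  with r have "dist (X (r (Suc n))) (X (r n)) < (1/2) ^ n" for n
    by (intro N) (metis le_add1 order_trans, metis)
  moreover have "strict_mono r"
    by (simp add: strict_mono_Suc_iff r)
  ultimately show thesis
    using that by blast
qed

text \<open>The L1 norm is dominated by the L2 norm, so the sum of all increments \<open>h n\<close>
  has integral at most the sum of a geometric series. It is thus finite a.e., and at such points the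
  telescoping series of increments converges absolutely.\<close>

lemma AE_convergent_if_rapid:
  assumes f: "\<And>n. sq_integrable (f n)"
    and rapid: "\<And>n. norm (toLsq (f (Suc n)) - toLsq (f n)) \<le> (1/2) ^ n"
  shows "AE x in leb01. convergent (\<lambda>n. f n x)"
proof -
  define h where "h n x = cmod (f (Suc n) x - f n x)" for n x
  have [measurable]: "f n \<in> borel_measurable leb01" for n
    using f by (rule sq_integrable_measurable)
  have [measurable]: "h n \<in> borel_measurable leb01" for n
    unfolding h_def by measurable
  have d: "sq_integrable (\<lambda>x. f (Suc n) x - f n x)" for n
    by (intro sq_integrable_diff f)
  have "(\<integral>\<^sup>+x. ennreal (h n x) \<partial>leb01) \<le> ennreal ((1/2) ^ n)" for n
  proof -
    have "(\<integral>\<^sup>+x. ennreal (h n x) \<partial>leb01) = ennreal (\<integral>x. h n x \<partial>leb01)"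
      using sq_integrable_imp_integrable[OF d[of n]]
      by (intro nn_integral_eq_integral) (auto simp: h_def)
    also have "\<dots> \<le> ennreal ((1/2) ^ n)"
      unfolding h_def using integral_norm_le_norm_toLsq[OF d[of n]] rapid[of n]
      by (intro ennreal_leI) (simp add: toLsq_diff f)
    finally show ?thesis .
  qed
  then have "(\<Sum>n. \<integral>\<^sup>+x. ennreal (h n x) \<partial>leb01) \<le> (\<Sum>n. ennreal ((1/2) ^ n))"
    by (intro suminf_le) auto
  also have "\<dots> = ennreal (\<Sum>n. (1/2) ^ n)"
    by (intro suminf_ennreal2) auto
  also have "\<dots> < \<infinity>"
    by simp
  finally have "(\<integral>\<^sup>+x. (\<Sum>n. ennreal (h n x)) \<partial>leb01) \<noteq> \<infinity>"
    by (subst nn_integral_suminf) auto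
  then have "AE x in leb01. (\<Sum>n. ennreal (h n x)) \<noteq> \<infinity>"
    by (intro nn_integral_PInf_AE) auto
  then show ?thesis
  proof eventually_elim
    case (elim x)
    then have "summable (\<lambda>n. h n x)"
      by (intro summable_suminf_not_top) (auto simp: h_def)
    then have "summable (\<lambda>n. f (Suc n) x - f n x)"
      unfolding h_def by (rule summable_norm_cancel)
    then have "convergent (\<lambda>n. \<Sum>i<n. f (Suc i) x - f i x)"
      by (simp add: summable_iff_convergent)
    then have "convergent (\<lambda>n. f n x - f 0 x)"
      by (simp only: sum_lessThan_telescope[of "\<lambda>n. f n x"])
    then show ?case
      using convergent_diff_const_right_iff by blast
  qed
qed

instance Lsq :: banach
proof
  fix X :: "nat \<Rightarrow> Lsq"
  assume X: "Cauchy X"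
  obtain r where r: "strict_mono r" and rapid: "\<And>n. dist (X (r (Suc n))) (X (r n)) < (1/2) ^ n"
    using Cauchy_rapid_subseq[OF X] by blast
  define f where "f n = rep_Lsq (X (r n))" for n
  have f: "sq_integrable (f n)" "toLsq (f n) = X (r n)" for n
    by (simp_all add: f_def sq_integrable_rep_Lsq toLsq_rep_Lsq)
  have [measurable]: "f n \<in> borel_measurable leb01" for n
    using f(1) by (rule sq_integrable_measurable)
  \<comment> \<open>Where the sequence diverges, \<open>lim\<close> is an unspecified value; this
    happens only on a null set, and the function stays measurable.\<close>
  define F where "F x = lim (\<lambda>n. f n x)" for x
  have [measurable]: "F \<in> borel_measurable leb01"
    unfolding F_def by measurable
  have "norm (toLsq (f (Suc n)) - toLsq (f n)) \<le> (1/2) ^ n" for n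
    using rapid[of n] by (simp add: f dist_norm)
  then have "AE x in leb01. convergent (\<lambda>n. f n x)"
    using f(1) by (intro AE_convergent_if_rapid)
  then have lim: "AE x in leb01. (\<lambda>n. f n x) \<longlonglongrightarrow> F x"
    by eventually_elim (simp add: F_def convergent_LIMSEQ_iff)
  have Fatou: "sq_integrable (\<lambda>x. F x - f n x)" "norm (toLsq (\<lambda>x. F x - f n x)) \<le> e"
    if e: "0 \<le> e" and N: "\<And>m. m \<ge> N \<Longrightarrow> dist (X (r m)) (X (r n)) \<le> e" for n N e
  proof -
    have bound: "(\<integral>\<^sup>+x. ennreal ((cmod (f m x - f n x))\<^sup>2) \<partial>leb01) \<le> ennreal (e\<^sup>2)" if "m \<ge> N" for m
      using N[OF that] f
      by (subst nn_integral_sq_norm)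
        (auto simp: sq_integrable_diff toLsq_diff dist_norm intro!: ennreal_leI power_mono)
    have "AE x in leb01. ennreal ((cmod (F x - f n x))\<^sup>2)
        = liminf (\<lambda>m. ennreal ((cmod (f m x - f n x))\<^sup>2))"
      using lim
    proof eventually_elim
      case (elim x)
      then have "(\<lambda>m. ennreal ((cmod (f m x - f n x))\<^sup>2)) \<longlonglongrightarrow> ennreal ((cmod (F x - f n x))\<^sup>2)"
        by (intro tendsto_intros)
      then show ?case
        by (simp only: lim_imp_Liminf[OF sequentially_bot])
    qed
    then have "(\<integral>\<^sup>+x. ennreal ((cmod (F x - f n x))\<^sup>2) \<partial>leb01)
        = (\<integral>\<^sup>+x. liminf (\<lambda>m. ennreal ((cmod (f m x - f n x))\<^sup>2)) \<partial>leb01)"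
      by (rule nn_integral_cong_AE)
    also have "\<dots> \<le> liminf (\<lambda>m. \<integral>\<^sup>+x. ennreal ((cmod (f m x - f n x))\<^sup>2) \<partial>leb01)"
      by (rule nn_integral_liminf) measurable
    also have "\<dots> \<le> liminf (\<lambda>m. ennreal (e\<^sup>2))"
      using bound by (intro Liminf_mono) (auto simp: eventually_sequentially)
    also have "\<dots> = ennreal (e\<^sup>2)"
      by (simp add: Liminf_const)
    finally show "sq_integrable (\<lambda>x. F x - f n x)" "norm (toLsq (\<lambda>x. F x - f n x)) \<le> e"
      using e by (intro sq_integrable_if_nn_integral_le; simp)+
  qed
  have Xr: "Cauchy (X \<circ> r)"
    using X r by (rule Cauchy_subseq_Cauchy)
  have tail: "\<exists>N. \<forall>n\<ge>N. sq_integrable (\<lambda>x. F x - f n x) \<and> norm (toLsq (\<lambda>x. F x - f n x)) \<le> e"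
    if e: "0 < e" for e
  proof -
    obtain N where "\<And>m n. m \<ge> N \<Longrightarrow> n \<ge> N \<Longrightarrow> dist (X (r m)) (X (r n)) < e"
      using Xr e unfolding Cauchy_def comp_def by meson
    with e have "sq_integrable (\<lambda>x. F x - f n x) \<and> norm (toLsq (\<lambda>x. F x - f n x)) \<le> e"
      if "n \<ge> N" for n
      using Fatou[of e N n] that by (simp add: less_imp_le)
    then show ?thesis by blast
  qed
  from tail[of 1] obtain N where "sq_integrable (\<lambda>x. F x - f N x)"
    by auto
  from sq_integrable_add[OF this f(1)[of N]] have F: "sq_integrable F"
    by simp
  have "(X \<circ> r) \<longlonglongrightarrow> toLsq F"
  proof (rule metric_LIMSEQ_I)
    fix e :: real
    assume "0 < e"
    with tail[of "e/2"] obtain N where "\<And>n. n \<ge> N \<Longrightarrow> norm (toLsq (\<lambda>x. F x - f n x)) \<le> e/2"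
      by auto
    with F f \<open>0 < e\<close> have "dist ((X \<circ> r) n) (toLsq F) < e" if "n \<ge> N" for n
      using that by (fastforce simp: toLsq_diff dist_norm norm_minus_commute)
    then show "\<exists>N. \<forall>n\<ge>N. dist ((X \<circ> r) n) (toLsq F) < e" by blast
  qed
  with Cauchy_converges_subseq[OF X r] show "convergent X"
    by (auto simp: convergent_def)
qed

section \<open>Absolutely continuous functions\<close>

text \<open>The linear approximation at the tag \<open>x\<close> is used at both end points; since
  \<open>x\<close> lies between them, the two errors add up to \<open>e\<close> times the full
  length.\<close>

lemma norm_diff_le_straddle:
  fixes F :: "real \<Rightarrow> 'a::real_normed_vector"
  assumes "\<And>y. y \<in> {u..v} \<Longrightarrow> norm (F y - F x - (y - x) *\<^sub>R D) \<le> e * \<bar>y - x\<bar>" "x \<in> {u..v}"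
  shows "norm ((v - u) *\<^sub>R D - (F v - F u)) \<le> e * (v - u)"
proof -
  have "norm ((v - u) *\<^sub>R D - (F v - F u))
      = norm ((F u - F x - (u - x) *\<^sub>R D) - (F v - F x - (v - x) *\<^sub>R D))"
    by (simp add: algebra_simps)
  also have "\<dots> \<le> e * \<bar>u - x\<bar> + e * \<bar>v - x\<bar>"
    by (rule order_trans[OF norm_triangle_ineq4 add_mono]) (use assms(1)[of u] assms(1)[of v] assms(2) in auto)
  also have "\<dots> = e * (v - u)"
    using assms(2) by (auto simp: algebra_simps)
  finally show ?thesis .
qed

lemma sum_length_le_measure:
  fixes I :: "(real \<times> real) set"
  assumes "finite I" "disjoint_family_on (\<lambda>(s, t). {s<..<t}) I"
    and "\<And>s t. (s, t) \<in> I \<Longrightarrow> s \<le> t \<and> {s<..<t} \<subseteq> U" "U \<in> lmeasurable"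
  shows "(\<Sum>(s, t)\<in>I. t - s) \<le> measure lebesgue U"
proof -
  have "(\<Sum>(s, t)\<in>I. t - s) = (\<Sum>i\<in>I. measure lebesgue ((\<lambda>(s, t). {s<..<t}) i))"
    using assms(3) by (intro sum.cong) (auto simp: case_prod_beta)
  also have "\<dots> = measure lebesgue (\<Union>i\<in>I. (\<lambda>(s, t). {s<..<t}) i)"
    using assms(1-3) by (intro measure_finite_Union[symmetric]) auto
  also have "\<dots> \<le> measure lebesgue U"
    using assms by (intro measure_mono_fmeasurable) (auto intro!: sets.finite_UN)
  finally show ?thesis .
qed

text \<open>Gauge proof: off the exceptional set the derivative controls each subinterval, and the
  subintervals tagged in the exceptional set lie in an open set of small measure, where absolute
  continuity applies.\<close>

lemma has_integral_abs_continuous_on: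
  fixes F :: "real \<Rightarrow> complex"
  assumes F: "abs_continuous_on c d F" and cd: "c \<le> d" and N: "negligible N"
    and der: "\<And>x. x \<in> {c..d} - N \<Longrightarrow> (F has_vector_derivative f x) (at x within {c..d})"
  shows "(f has_integral F d - F c) {c..d}"
proof (rule has_integral_spike[OF N])
  \<comment> \<open>Nothing is known about \<open>f\<close> on \<open>N\<close>. With the value 0
    there, subintervals tagged in \<open>N\<close> contribute nothing to the Riemann sum, only the
    increments of \<open>F\<close>.\<close>
  define g where "g x = (if x \<in> N then 0 else f x)" for x
  show "f x = g x" if "x \<in> {c..d} - N" for x
    using that by (simp add: g_def)
  show "(g has_integral F d - F c) {c..d}"
    unfolding has_integral_real
  proof (intro allI impI)
    fix e :: real
    assume "0 < e"
    \<comment> \<open>Summed over all subintervals this gives at most \<open>e / 2\<close>; the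
      added 1 keeps the denominator positive when \<open>c = d\<close>.\<close>
    define e1 where "e1 = e / (2 * (d - c + 1))"
    have e1: "0 < e1"
      using \<open>0 < e\<close> cd by (simp add: e1_def)
    have e1_le: "e1 * (d - c) \<le> e / 2"
      using \<open>0 < e\<close> cd by (simp add: e1_def field_simps)
    obtain \<delta> where "0 < \<delta>" and \<delta>: "\<And>I :: (real \<times> real) set.
       finite I \<Longrightarrow> (\<forall>(s, t)\<in>I. c \<le> s \<and> s \<le> t \<and> t \<le> d) \<Longrightarrow>
       disjoint_family_on (\<lambda>(s, t). {s<..<t}) I \<Longrightarrow> (\<Sum>(s, t)\<in>I. t - s) < \<delta> \<Longrightarrow>
       (\<Sum>(s, t)\<in>I. cmod (F t - F s)) < e / 2"
      using F[unfolded abs_continuous_on_def, rule_format, of "e / 2"] \<open>0 < e\<close> by (auto simp: case_prod_beta)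
    have "N \<in> sets lebesgue" "emeasure lebesgue N = 0"
      using N by (auto simp: negligible_iff_null_sets)
    then obtain U where U: "open U" "N \<subseteq> U" "emeasure lebesgue (U - N) < ennreal \<delta>"
      using sets_lebesgue_outer_open[of N \<delta>] \<open>0 < \<delta>\<close> by metis
    have emU: "emeasure lebesgue U < ennreal \<delta>"
      using U N by (subst (asm) emeasure_Diff_null_set) (auto simp: negligible_iff_null_sets)
    then have lmU: "U \<in> lmeasurable"
      using U(1) by (intro fmeasurableI) (auto intro: less_trans)
    have mU: "measure lebesgue U < \<delta>"
      using emU \<open>0 < \<delta>\<close> unfolding emeasure_eq_measure2[OF lmU] by (simp add: ennreal_less_iff)
    have "\<exists>r>0. x \<in> {c..d} - N \<longrightarrow> (\<forall>y\<in>{c..d}. \<bar>y - x\<bar> < r \<longrightarrow>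
        norm (F y - F x - (y - x) *\<^sub>R f x) \<le> e1 * \<bar>y - x\<bar>)" for x
    proof (cases "x \<in> {c..d} - N")
      case True
      from der[OF this] e1 show ?thesis
        unfolding has_vector_derivative_def has_derivative_within_alt by auto
    qed (use zero_less_one in blast)
    then obtain r where r: "\<And>x. 0 < r x" "\<And>x y. \<lbrakk>x \<in> {c..d} - N; y \<in> {c..d}; \<bar>y - x\<bar> < r x\<rbrakk>
        \<Longrightarrow> norm (F y - F x - (y - x) *\<^sub>R f x) \<le> e1 * \<bar>y - x\<bar>"
      by metis
    \<comment> \<open>Off \<open>N\<close> the gauge enforces the derivative estimate; on
      \<open>N\<close> it forces the subinterval into \<open>U\<close>, whose measure is below the
      \<delta> of absolute continuity.\<close>
    define \<gamma> where "\<gamma> x = (if x \<in> N then U else ball x (r x))" for x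
    have gauge: "gauge \<gamma>"
      using U r(1) by (auto simp: gauge_def \<gamma>_def)
    have main: "norm ((\<Sum>(x, K)\<in>p. measure lborel K *\<^sub>R g x) - (F d - F c)) < e"
      if p: "p tagged_division_of {c..d}" and fine: "\<gamma> fine p" for p
    proof -
      note pD = tagged_division_ofD[OF p]
      have K: "Inf K \<le> x \<and> x \<le> Sup K \<and> K = {Inf K..Sup K} \<and> c \<le> Inf K \<and> Sup K \<le> d
          \<and> measure lborel K = Sup K - Inf K \<and> K \<subseteq> \<gamma> x"
        if xK: "(x, K) \<in> p" for x K
      proof -
        obtain u v where uv: "K = {u..v}"
          using pD(4)[OF xK] by auto
        with pD(2)[OF xK] have "u \<le> v" by auto
        moreover have "K \<subseteq> \<gamma> x"
          using fine xK by (auto simp: fine_def)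
        moreover have "x \<in> K" "K \<subseteq> {c..d}"
          using pD(2,3)[OF xK] by auto
        ultimately show ?thesis
          using uv by auto
      qed
      define p1 where "p1 = {(x, K) \<in> p. x \<notin> N}"
      define p2 where "p2 = {(x, K) \<in> p. x \<in> N}"
      have fin: "finite p" "finite p1" "finite p2"
        using pD(1) by (auto simp: p1_def p2_def intro: finite_subset[of _ p])
      have split: "sum h p = sum h p1 + sum h p2" for h :: "real \<times> real set \<Rightarrow> 'b::comm_monoid_add"
      proof -
        have "p = p1 \<union> p2" "p1 \<inter> p2 = {}"
          by (auto simp: p1_def p2_def)
        then show ?thesis
          using fin by (metis sum.union_disjoint)
      qed
      have "norm (\<Sum>(x, K)\<in>p1. measure lborel K *\<^sub>R g x - (F (Sup K) - F (Inf K)))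
          \<le> (\<Sum>(x, K)\<in>p1. e1 * (Sup K - Inf K))"
      proof (rule sum_norm_le, clarify)
        fix x K
        assume "(x, K) \<in> p1"
        then have xK: "(x, K) \<in> p" "x \<notin> N"
          by (auto simp: p1_def)
        note K = K[OF xK(1)]
        have "norm ((Sup K - Inf K) *\<^sub>R f x - (F (Sup K) - F (Inf K))) \<le> e1 * (Sup K - Inf K)"
        proof (rule norm_diff_le_straddle)
          fix y assume y: "y \<in> {Inf K..Sup K}"
          with K have "y \<in> {c..d}"
            by (meson atLeastAtMost_iff order_trans)
          from y K have "y \<in> \<gamma> x" by auto
          then have yx: "\<bar>y - x\<bar> < r x"
            using xK by (simp add: \<gamma>_def dist_real_def)
          then show "norm (F y - F x - (y - x) *\<^sub>R f x) \<le> e1 * \<bar>y - x\<bar>"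
            using xK K by (intro r(2)[OF _ \<open>y \<in> {c..d}\<close> yx]) (metis DiffI atLeastAtMost_iff order_trans)
        qed (use K in auto)
        then show "norm (measure lborel K *\<^sub>R g x - (F (Sup K) - F (Inf K))) \<le> e1 * (Sup K - Inf K)"
          using K xK by (simp add: g_def)
      qed
      also have "\<dots> \<le> (\<Sum>(x, K)\<in>p. e1 * (Sup K - Inf K))"
      proof (rule sum_mono2)
        show "0 \<le> (case i of (x, K) \<Rightarrow> e1 * (Sup K - Inf K))" if "i \<in> p - p1" for i
          using that e1 K[of "fst i" "snd i"] by (simp add: case_prod_beta)
      qed (use fin in \<open>auto simp: p1_def\<close>)
      also have "\<dots> = e1 * (d - c)"
        using additive_tagged_division_1[OF cd p, of "\<lambda>x. x"]
        by (simp add: case_prod_beta flip: sum_distrib_left)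
      finally have bound1: "norm (\<Sum>(x, K)\<in>p1. measure lborel K *\<^sub>R g x - (F (Sup K) - F (Inf K))) \<le> e / 2"
        using e1_le by simp
      define I where "I = (\<lambda>(x, K). (Inf K, Sup K)) ` p2"
      \<comment> \<open>A set of intervals forgets tags, so no increment may be lost. Two different
        tags could share an interval only if its interior were empty, but then it is one point and
        the tags coincide.\<close>
      have inj: "inj_on (\<lambda>(x, K). (Inf K, Sup K)) p2"
      proof (rule inj_onI, clarify)
        fix x K x' K'
        assume mem: "(x, K) \<in> p2" "(x', K') \<in> p2" and eq: "Inf K = Inf K'" "Sup K = Sup K'"
        then have mem': "(x, K) \<in> p" "(x', K') \<in> p" by (auto simp: p2_def)
        have KK: "K = K'"
          using K[OF mem'(1)] K[OF mem'(2)] eq by simp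
        moreover have "x = x'"
        proof (rule ccontr)
          assume "x \<noteq> x'"
          with pD(5)[OF mem'] KK have "interior K = {}" by auto
          then have "interior {Inf K..Sup K} = {}"
            using K[OF mem'(1)] by metis
          then have "Sup K \<le> Inf K"
            by (simp only: interior_atLeastAtMost_real greaterThanLessThan_empty_iff)
          with K[OF mem'(1)] K[OF mem'(2)] KK \<open>x \<noteq> x'\<close> show False by auto
        qed
        ultimately show "x = x' \<and> K = K'" by simp
      qed
      have I_mem: "\<exists>x K. (x, K) \<in> p \<and> x \<in> N \<and> s = Inf K \<and> t = Sup K" if "(s, t) \<in> I" for s t
        using that by (auto simp: I_def p2_def)
      have disj: "disjoint_family_on (\<lambda>(s, t). {s<..<t}) I"
        unfolding disjoint_family_on_def
      proof (intro ballI impI)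
        fix i i' assume i: "i \<in> I" "i' \<in> I" "i \<noteq> i'"
        obtain x K where xK: "(x, K) \<in> p" "i = (Inf K, Sup K)"
          using i(1) by (auto simp: I_def p2_def)
        obtain x' K' where xK': "(x', K') \<in> p" "i' = (Inf K', Sup K')"
          using i(2) by (auto simp: I_def p2_def)
        have "(x, K) \<noteq> (x', K')"
          using i(3) xK xK' by auto
        from pD(5)[OF xK(1) xK'(1) this]
        have "interior {Inf K..Sup K} \<inter> interior {Inf K'..Sup K'} = {}"
          using K[OF xK(1)] K[OF xK'(1)] by metis
        then show "(\<lambda>(s, t). {s<..<t}) i \<inter> (\<lambda>(s, t). {s<..<t}) i' = {}"
          by (simp add: xK xK')
      qed
      have I_len: "(\<Sum>(s, t)\<in>I. t - s) < \<delta>"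
      proof (rule le_less_trans[OF sum_length_le_measure mU])
        show "s \<le> t \<and> {s<..<t} \<subseteq> U" if "(s, t) \<in> I" for s t
        proof -
          obtain x K' where xK: "(x, K') \<in> p" "x \<in> N" "s = Inf K'" "t = Sup K'"
            using I_mem[OF \<open>(s, t) \<in> I\<close>] by blast
          have "{s<..<t} \<subseteq> {s..t}" by auto
          with K[OF xK(1)] xK show ?thesis by (auto simp: \<gamma>_def)
        qed
      qed (use disj lmU fin in \<open>auto simp: I_def\<close>)
      have "norm (\<Sum>(x, K)\<in>p2. measure lborel K *\<^sub>R g x - (F (Sup K) - F (Inf K)))
          \<le> (\<Sum>(x, K)\<in>p2. cmod (F (Sup K) - F (Inf K)))"
        by (rule sum_norm_le) (auto simp: p2_def g_def norm_minus_commute)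
      also have "\<dots> = (\<Sum>(s, t)\<in>I. cmod (F t - F s))"
        unfolding I_def by (subst sum.reindex[OF inj]) (auto simp: case_prod_beta)
      also have "\<dots> < e / 2"
      proof (rule \<delta>)
        show "\<forall>(s, t)\<in>I. c \<le> s \<and> s \<le> t \<and> t \<le> d"
        proof clarify
          fix s t assume "(s, t) \<in> I"
          from I_mem[OF this] obtain x K' where "(x, K') \<in> p" "s = Inf K'" "t = Sup K'"
            by blast
          with K[of x K'] show "c \<le> s \<and> s \<le> t \<and> t \<le> d" by auto
        qed
      qed (use disj I_len fin in \<open>auto simp: I_def\<close>)
      finally have bound2: "norm (\<Sum>(x, K)\<in>p2. measure lborel K *\<^sub>R g x - (F (Sup K) - F (Inf K))) < e / 2" .
      \<comment> \<open>\<open>F d - F c\<close> telescopes over the division, so the total error is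
        the sum of the errors over \<open>p1\<close> and \<open>p2\<close>.\<close>
      have "(\<Sum>(x, K)\<in>p. measure lborel K *\<^sub>R g x) - (F d - F c)
          = (\<Sum>(x, K)\<in>p. measure lborel K *\<^sub>R g x - (F (Sup K) - F (Inf K)))"
        unfolding additive_tagged_division_1[OF cd p, symmetric]
        by (simp add: case_prod_beta sum_subtractf)
      also have "norm \<dots> < e"
        unfolding split by (rule norm_triangle_lt) (use bound1 bound2 in linarith)
      finally show ?thesis .
    qed
    show "\<exists>\<gamma>. gauge \<gamma> \<and> (\<forall>p. p tagged_division_of {c..d} \<and> \<gamma> fine p \<longrightarrow>
        norm ((\<Sum>(x, K)\<in>p. measure lborel K *\<^sub>R g x) - (F d - F c)) < e)"
      by (intro exI[of _ \<gamma>] conjI allI impI gauge, elim conjE, rule main)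
  qed
qed

section \<open>Differentiation and absolute continuity of indefinite integrals\<close>

text \<open>\<open>integrable_ccontinuous_explicit\<close> controls averages over intervals to the
  right of a point only. Applied to the reflected function it controls those to the left. Only
  integrals between \<open>x\<close> and \<open>y\<close> enter, so one \<open>N\<close> serves
  every base point \<open>a\<close>.\<close>

lemma AE_derivative_indefinite_integral:
  fixes g :: "real \<Rightarrow> complex"
  assumes g: "\<And>a b. g integrable_on {a..b}"
  obtains N where "negligible N"
    "\<And>a x. x \<notin> N \<Longrightarrow> a < x \<Longrightarrow> ((\<lambda>y. integral {a..y} g) has_vector_derivative g x) (at x)"
proof -
  obtain N1 where N1: "negligible N1" "\<And>x e. x \<notin> N1 \<Longrightarrow> 0 < e \<Longrightarrow>
      \<exists>d>0. \<forall>h. 0 < h \<and> h < d \<longrightarrow> norm (integral {x..x + h} g /\<^sub>R h - g x) < e"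
    using integrable_ccontinuous_explicit[of g] g by auto
  have "(\<lambda>x. g (- x)) integrable_on {a..b}" for a b
    using g[of "-b" "-a"] Henstock_Kurzweil_Integration.integrable_reflect_real[where f = g and a = "-b" and b = "-a"] by simp
  then obtain N2 where N2: "negligible N2" "\<And>x e. x \<notin> N2 \<Longrightarrow> 0 < e \<Longrightarrow>
      \<exists>d>0. \<forall>h. 0 < h \<and> h < d \<longrightarrow> norm (integral {x..x + h} (\<lambda>x. g (- x)) /\<^sub>R h - g (- x)) < e"
    using integrable_ccontinuous_explicit[of "\<lambda>x. g (- x)"] by auto
  show thesis
  proof
    show "negligible (N1 \<union> uminus ` N2)"
      using N1(1) N2(1) by (intro negligible_Un negligible_differentiable_image_negligible)
        (auto intro!: derivative_intros simp: differentiable_on_def)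
    fix a x
    assume x: "x \<notin> N1 \<union> uminus ` N2" and "a < x"
    then have "- x \<notin> N2"
      by (metis UnCI image_eqI minus_minus)
    have step: "norm (c - h *\<^sub>R D) \<le> e * h" if "0 < h" "norm (c /\<^sub>R h - D) < e" for c D :: complex and e h
    proof -
      have "c - h *\<^sub>R D = h *\<^sub>R (c /\<^sub>R h - D)"
        using that(1) by (simp add: algebra_simps)
      then show ?thesis
        using that by (simp add: mult.commute[of e])
    qed
    show "((\<lambda>y. integral {a..y} g) has_vector_derivative g x) (at x)"
      unfolding has_vector_derivative_def has_derivative_within_alt
    proof (intro conjI allI impI bounded_linear_scaleR_left)
      fix e :: real
      assume "0 < e"
      obtain d1 where d1: "0 < d1" "\<And>h. 0 < h \<Longrightarrow> h < d1 \<Longrightarrow> norm (integral {x..x + h} g /\<^sub>R h - g x) < e"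
        using N1(2)[of x e] x \<open>0 < e\<close> by auto
      obtain d2 where d2: "0 < d2" "\<And>h. 0 < h \<Longrightarrow> h < d2 \<Longrightarrow>
          norm (integral {-x..-x + h} (\<lambda>x. g (- x)) /\<^sub>R h - g x) < e"
        using N2(2)[OF \<open>- x \<notin> N2\<close> \<open>0 < e\<close>] by auto
      \<comment> \<open>The third entry keeps \<open>y\<close> to the right of \<open>a\<close>, so
        that the integrals from \<open>a\<close> can be split at \<open>y\<close>.\<close>
      define d where "d = Min {d1, d2, x - a}"
      have "norm (integral {a..y} g - integral {a..x} g - (y - x) *\<^sub>R g x) \<le> e * norm (y - x)"
        if y: "norm (y - x) < d" for y
      proof -
        have yd: "\<bar>y - x\<bar> < d1" "\<bar>y - x\<bar> < d2" "\<bar>y - x\<bar> < x - a"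
          using y by (auto simp: d_def)
        consider "y = x" | "x < y" | "y < x" by linarith
        then show ?thesis
        proof cases
          case 2
          have "integral {a..x} g + integral {x..y} g = integral {a..y} g"
            using 2 \<open>a < x\<close> g by (intro Henstock_Kurzweil_Integration.integral_combine) auto
          then have "integral {a..y} g - integral {a..x} g = integral {x..y} g"
            by (simp add: algebra_simps)
          then show ?thesis
            using step[OF _ d1(2)[of "y - x"]] 2 yd by simp
        next
          case 3
          have "integral {a..y} g + integral {y..x} g = integral {a..x} g"
            using 3 \<open>a < x\<close> yd g by (intro Henstock_Kurzweil_Integration.integral_combine) auto
          then have "integral {a..y} g - integral {a..x} g - (y - x) *\<^sub>R g x
              = - (integral {y..x} g - (x - y) *\<^sub>R g x)"
            by (simp add: algebra_simps)
          moreover have "integral {-x..-y} (\<lambda>x. g (- x)) = integral {y..x} g"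
            by (rule Henstock_Kurzweil_Integration.integral_reflect_real)
          ultimately show ?thesis
            using step[OF _ d2(2)[of "x - y"]] 3 yd by (simp add: norm_minus_commute)
        qed simp
      qed
      then show "\<exists>d>0. \<forall>y\<in>UNIV. norm (y - x) < d \<longrightarrow>
          norm (integral {a..y} g - integral {a..x} g - (y - x) *\<^sub>R g x) \<le> e * norm (y - x)"
        using d1(1) d2(1) \<open>a < x\<close> by (intro exI[of _ d]) (auto simp: d_def)
    qed
  qed
qed

text \<open>Absolute continuity speaks of disjoint open intervals, the integrals of closed ones. The
  closed intervals meet at most in end points, also if some are degenerate, so the overlaps are
  negligible.\<close>

lemma sum_integral_disjoint_le:
  fixes q :: "real \<Rightarrow> real"
  assumes q: "q integrable_on {c..d}" and pos: "\<And>x. 0 \<le> q x"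
    and I: "finite I" "\<forall>(s, t)\<in>I. c \<le> s \<and> s \<le> t \<and> t \<le> d" "disjoint_family_on (\<lambda>(s, t). {s<..<t}) I"
  shows "(\<Sum>(s, t)\<in>I. integral {s..t} q) \<le> integral {c..d} q"
proof -
  have "(q has_integral (\<Sum>i\<in>I. integral {fst i..snd i} q)) (\<Union>i\<in>I. {fst i..snd i})"
  proof (rule has_integral_UN[OF I(1)])
    show "(q has_integral integral {fst i..snd i} q) {fst i..snd i}" if "i \<in> I" for i
      using that I(2) by (intro integrable_integral integrable_subinterval_real[OF q]) auto
    show "pairwise (\<lambda>i i'. negligible ({fst i..snd i} \<inter> {fst i'..snd i'})) I"
    proof (rule pairwiseI)
      fix i i' assume "i \<in> I" "i' \<in> I" "i \<noteq> i'"
      with I(3) have "{fst i<..<snd i} \<inter> {fst i'<..<snd i'} = {}"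
        by (simp add: disjoint_family_on_def case_prod_beta)
      moreover have "{u..v} \<subseteq> {u<..<v} \<union> {u, v}" for u v :: real
        by auto
      ultimately have "{fst i..snd i} \<inter> {fst i'..snd i'} \<subseteq> {fst i, snd i, fst i', snd i'}"
        by blast
      then show "negligible ({fst i..snd i} \<inter> {fst i'..snd i'})"
        by (rule negligible_subset[rotated]) simp
    qed
  qed
  moreover have "{fst i..snd i} \<subseteq> {c..d}" if "i \<in> I" for i
    using I(2) that by (auto simp: case_prod_beta)
  ultimately have "(\<Sum>i\<in>I. integral {fst i..snd i} q) \<le> integral {c..d} q"
    using pos by (intro has_integral_subset_le[OF UN_least _ integrable_integral[OF q]]) auto
  then show ?thesis
    by (simp add: case_prod_beta)
qed

text \<open>Square integrability makes the uniform estimate elementary: \<open>\<bar>y\<bar> \<le> \<eta> + y\<^sup>2 / (4 \<eta>)\<close>.\<close>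

lemma abs_continuous_on_if_increments_le:
  fixes g F :: "real \<Rightarrow> complex"
  assumes g: "g integrable_on {c..d}" and g2: "(\<lambda>x. (cmod (g x))\<^sup>2) integrable_on {c..d}"
    and F: "\<And>s t. c \<le> s \<Longrightarrow> s \<le> t \<Longrightarrow> t \<le> d \<Longrightarrow> cmod (F t - F s) \<le> cmod (integral {s..t} g)"
  shows "abs_continuous_on c d F"
  unfolding abs_continuous_on_def
proof (intro allI impI)
  fix e :: real
  assume "0 < e"
  let ?q = "\<lambda>x. (cmod (g x))\<^sup>2"
  define k where "k = integral {c..d} ?q"
  \<comment> \<open>Then \<open>k / (4 * \<eta>)\<close> is less than a quarter of \<open>e\<close>;
    the added 1 keeps \<eta> positive when \<open>k = 0\<close>. The other term, \<eta> times the
    total length, dictates the choice \<open>e / (2 * \<eta>)\<close> for \<delta>.\<close>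
  define \<eta> where "\<eta> = (k + 1) / e"
  have "0 \<le> k"
    unfolding k_def by (rule Henstock_Kurzweil_Integration.integral_nonneg[OF g2]) simp
  then have \<eta>: "0 < \<eta>"
    using \<open>0 < e\<close> by (simp add: \<eta>_def)
  have k_small: "k / (4 * \<eta>) < e / 2"
    using \<open>0 < e\<close> \<open>0 \<le> k\<close> by (simp add: \<eta>_def field_simps add_pos_nonneg)
  have incr: "cmod (F t - F s) \<le> \<eta> * (t - s) + integral {s..t} ?q / (4 * \<eta>)"
    if st: "c \<le> s" "s \<le> t" "t \<le> d" for s t
  proof -
    have sub: "g integrable_on {s..t}" "?q integrable_on {s..t}"
      using st g g2 by (auto intro: integrable_subinterval_real)
    have q4: "(\<lambda>x. ?q x / (4 * \<eta>)) integrable_on {s..t}"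
      using integrable_on_cmult_left[OF sub(2), of "1 / (4 * \<eta>)"] by simp
    have "cmod (g x) \<le> \<eta> + ?q x / (4 * \<eta>)" for x
    proof -
      have "0 \<le> (2 * \<eta> - cmod (g x))\<^sup>2" by simp
      then show ?thesis
        using \<eta> by (simp add: field_simps power2_eq_square)
    qed
    then have "cmod (integral {s..t} g) \<le> integral {s..t} (\<lambda>x. \<eta> + ?q x / (4 * \<eta>))"
      using sub q4
      by (intro Henstock_Kurzweil_Integration.integral_norm_bound_integral integrable_add) auto
    also have "\<dots> = \<eta> * (t - s) + integral {s..t} ?q / (4 * \<eta>)"
      using q4 st by (subst Henstock_Kurzweil_Integration.integral_add) (auto simp: mult.commute)
    finally show ?thesis
      using F[OF st] by simp
  qed
  show "\<exists>\<delta>>0. \<forall>I. finite I \<and> (\<forall>(s, t)\<in>I. c \<le> s \<and> s \<le> t \<and> t \<le> d) \<and>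
       disjoint_family_on (\<lambda>(s, t). {s<..<t}) I \<and> (\<Sum>(s, t)\<in>I. t - s) < \<delta>
       \<longrightarrow> (\<Sum>(s, t)\<in>I. cmod (F t - F s)) < e"
  proof (intro exI[of _ "e / (2 * \<eta>)"] conjI allI impI)
    show "0 < e / (2 * \<eta>)"
      using \<open>0 < e\<close> \<eta> by simp
    fix I :: "(real \<times> real) set"
    assume "finite I \<and> (\<forall>(s, t)\<in>I. c \<le> s \<and> s \<le> t \<and> t \<le> d) \<and>
       disjoint_family_on (\<lambda>(s, t). {s<..<t}) I \<and> (\<Sum>(s, t)\<in>I. t - s) < e / (2 * \<eta>)"
    then have I: "finite I" "\<forall>(s, t)\<in>I. c \<le> s \<and> s \<le> t \<and> t \<le> d"
       "disjoint_family_on (\<lambda>(s, t). {s<..<t}) I" "(\<Sum>(s, t)\<in>I. t - s) < e / (2 * \<eta>)"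
      by auto
    have "(\<Sum>(s, t)\<in>I. cmod (F t - F s)) \<le> (\<Sum>(s, t)\<in>I. \<eta> * (t - s) + integral {s..t} ?q / (4 * \<eta>))"
      using I(2) by (intro sum_mono) (auto intro!: incr)
    also have "\<dots> = \<eta> * (\<Sum>(s, t)\<in>I. t - s) + (\<Sum>(s, t)\<in>I. integral {s..t} ?q) / (4 * \<eta>)"
      by (simp add: case_prod_beta sum.distrib sum_distrib_left sum_divide_distrib)
    also have "\<dots> < e / 2 + e / 2"
    proof (rule add_strict_mono)
      show "\<eta> * (\<Sum>(s, t)\<in>I. t - s) < e / 2"
        using I(4) \<eta> by (simp add: field_simps)
      have "(\<Sum>(s, t)\<in>I. integral {s..t} ?q) / (4 * \<eta>) \<le> k / (4 * \<eta>)"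
        using sum_integral_disjoint_le[OF g2 _ I(1-3)] \<eta> unfolding k_def
        by (intro divide_right_mono) auto
      with k_small show "(\<Sum>(s, t)\<in>I. integral {s..t} ?q) / (4 * \<eta>) < e / 2" by simp
    qed
    finally show "(\<Sum>(s, t)\<in>I. cmod (F t - F s)) < e" by simp
  qed
qed

lemma abs_continuous_on_subset:
  assumes "abs_continuous_on c d F" "c \<le> c'" "d' \<le> d"
  shows "abs_continuous_on c' d' F"
  unfolding abs_continuous_on_def
proof (intro allI impI)
  fix e :: real
  assume "0 < e"
  with assms(1) obtain \<delta> where "0 < \<delta>" and \<delta>: "\<And>I :: (real \<times> real) set.
       finite I \<and> (\<forall>(s, t)\<in>I. c \<le> s \<and> s \<le> t \<and> t \<le> d) \<and>
       disjoint_family_on (\<lambda>(s, t). {s<..<t}) I \<and> (\<Sum>(s, t)\<in>I. t - s) < \<delta> \<Longrightarrow>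
       (\<Sum>(s, t)\<in>I. cmod (F t - F s)) < e"
    unfolding abs_continuous_on_def by blast
  have "\<forall>(s, t)\<in>I. c \<le> s \<and> s \<le> t \<and> t \<le> d" if "\<forall>(s, t)\<in>I. c' \<le> s \<and> s \<le> t \<and> t \<le> d'" for I
    using that assms(2,3) order_trans by blast
  note sub = this
  show "\<exists>\<delta>>0. \<forall>I. finite I \<and> (\<forall>(s, t)\<in>I. c' \<le> s \<and> s \<le> t \<and> t \<le> d') \<and>
       disjoint_family_on (\<lambda>(s, t). {s<..<t}) I \<and> (\<Sum>(s, t)\<in>I. t - s) < \<delta>
       \<longrightarrow> (\<Sum>(s, t)\<in>I. cmod (F t - F s)) < e"
    by (intro exI[of _ \<delta>] conjI allI impI \<open>0 < \<delta>\<close>, rule \<delta>, elim conjE, intro conjI sub)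
qed

section \<open>The inverse of \<open>T\<^sup>*T\<close>\<close>

lemma AE_leb01_iff_negligible:
  "(AE x in leb01. P x) \<longleftrightarrow> (\<exists>N. negligible N \<and> (\<forall>x\<in>{0<..<1} - N. P x))"
proof
  assume "AE x in leb01. P x"
  then have "AE x in lebesgue. x \<in> {0<..<1} \<longrightarrow> P x"
    by (simp add: AE_restrict_space_iff)
  then obtain N where "N \<in> null_sets lebesgue" "{x \<in> space lebesgue. \<not> (x \<in> {0<..<1} \<longrightarrow> P x)} \<subseteq> N"
    unfolding eventually_ae_filter by blast
  then show "\<exists>N. negligible N \<and> (\<forall>x\<in>{0<..<1} - N. P x)"
    by (intro exI[of _ N]) (auto simp: negligible_iff_null_sets)
next
  assume "\<exists>N. negligible N \<and> (\<forall>x\<in>{0<..<1} - N. P x)"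
  then obtain N where "N \<in> null_sets lebesgue" "\<forall>x\<in>{0<..<1} - N. P x"
    by (auto simp: negligible_iff_null_sets)
  then show "AE x in leb01. P x"
    by (subst AE_restrict_space_iff) (auto intro: AE_I')
qed

section \<open>Iterated primitives from 0\<close>

text \<open>Square integrability constrains a function only on the open interval. Extension by 0
  makes it integrable over every compact interval, as
  \<open>AE_derivative_indefinite_integral\<close> demands.\<close>

definition zero_ext :: "(real \<Rightarrow> complex) \<Rightarrow> real \<Rightarrow> complex" where
  "zero_ext g x = (if x \<in> {0<..<1} then g x else 0)"

lemma norm_zero_ext: "cmod (zero_ext g x) = (if x \<in> {0<..<1} then cmod (g x) else 0)"
  and sq_norm_zero_ext: "(cmod (zero_ext g x))\<^sup>2 = (if x \<in> {0<..<1} then (cmod (g x))\<^sup>2 else 0)"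
  by (simp_all add: zero_ext_def)

definition primitive :: "(real \<Rightarrow> complex) \<Rightarrow> real \<Rightarrow> complex" where
  "primitive g x = integral {0..x} (zero_ext g)"

definition primitive2 :: "(real \<Rightarrow> complex) \<Rightarrow> real \<Rightarrow> complex" where
  "primitive2 g x = integral {0..x} (primitive g)"

lemma integrable_on_if_leb01:
  fixes f :: "real \<Rightarrow> 'a::euclidean_space"
  assumes "integrable leb01 f"
  shows "(\<lambda>x. if x \<in> {0<..<1} then f x else 0) integrable_on {a..b}"
proof (rule integrable_on_subinterval)
  show "(\<lambda>x. if x \<in> {0<..<1} then f x else 0) integrable_on UNIV"
    unfolding Henstock_Kurzweil_Integration.integrable_restrict_UNIV
    by (rule integrable_on_lebesgue_on[OF assms]) simp
qed simp

lemma zero_ext_integrable_on: "sq_integrable g \<Longrightarrow> zero_ext g integrable_on {a..b}"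
  unfolding zero_ext_def by (intro integrable_on_if_leb01 sq_integrable_imp_integrable)

lemma norm_zero_ext_integrable_on: "sq_integrable g \<Longrightarrow> (\<lambda>x. cmod (zero_ext g x)) integrable_on {a..b}"
  using integrable_on_if_leb01[OF integrable_norm[OF sq_integrable_imp_integrable], of g a b]
  by (simp only: norm_zero_ext)

lemma sq_norm_zero_ext_integrable_on:
  "sq_integrable g \<Longrightarrow> (\<lambda>x. (cmod (zero_ext g x))\<^sup>2) integrable_on {a..b}"
  unfolding sq_norm_zero_ext by (rule integrable_on_if_leb01) (simp add: sq_integrable_def)

lemma primitive_0 [simp]: "primitive g 0 = 0"
  by (simp add: primitive_def)

lemma primitive2_0 [simp]: "primitive2 g 0 = 0"
  by (simp add: primitive2_def)

lemma primitive_diff: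
  assumes "sq_integrable g" "0 \<le> s" "s \<le> t"
  shows "primitive g t - primitive g s = integral {s..t} (zero_ext g)"
  using Henstock_Kurzweil_Integration.integral_combine[OF assms(2,3) zero_ext_integrable_on[OF assms(1)]]
  by (simp add: primitive_def algebra_simps)

lemma continuous_on_primitive: "sq_integrable g \<Longrightarrow> continuous_on {0..b} (primitive g)"
  unfolding primitive_def by (intro indefinite_integral_continuous_1 zero_ext_integrable_on)

lemma primitive_integrable_on: "sq_integrable g \<Longrightarrow> primitive g integrable_on {0..b}"
  by (intro integrable_continuous_real continuous_on_primitive)

lemma norm_primitive_le:
  assumes g: "sq_integrable g" and x: "x \<in> {0..1}"
  shows "cmod (primitive g x) \<le> norm (toLsq g)"
proof -
  have ng: "integrable leb01 (\<lambda>x. cmod (g x))"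
    using sq_integrable_imp_integrable[OF g] by (rule integrable_norm)
  have "cmod (primitive g x) \<le> integral {0..x} (\<lambda>x. cmod (zero_ext g x))"
    unfolding primitive_def using g
    by (intro Henstock_Kurzweil_Integration.integral_norm_bound_integral
        zero_ext_integrable_on norm_zero_ext_integrable_on) auto
  also have "\<dots> \<le> integral UNIV (\<lambda>x. cmod (zero_ext g x))"
  proof (rule integral_subset_le)
    show "(\<lambda>x. cmod (zero_ext g x)) integrable_on UNIV"
      unfolding norm_zero_ext Henstock_Kurzweil_Integration.integrable_restrict_UNIV
      by (rule integrable_on_lebesgue_on[OF ng]) simp
  qed (use norm_zero_ext_integrable_on[OF g] in auto)
  also have "\<dots> = integral {0<..<1} (\<lambda>x. cmod (g x))"
    unfolding norm_zero_ext Henstock_Kurzweil_Integration.integral_restrict_UNIV ..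
  also have "\<dots> = (\<integral>x. cmod (g x) \<partial>leb01)"
    by (rule lebesgue_integral_eq_integral[OF ng, symmetric]) simp
  also have "\<dots> \<le> norm (toLsq g)"
    by (rule integral_norm_le_norm_toLsq[OF g])
  finally show ?thesis .
qed

lemma norm_primitive2_le:
  assumes g: "sq_integrable g" and x: "x \<in> {0..1}"
  shows "cmod (primitive2 g x) \<le> norm (toLsq g)"
proof -
  have "cmod (primitive2 g x) \<le> integral {0..x} (\<lambda>x. norm (toLsq g))"
    unfolding primitive2_def using x
    by (intro Henstock_Kurzweil_Integration.integral_norm_bound_integral
        primitive_integrable_on[OF g] norm_primitive_le[OF g]) auto
  also have "\<dots> \<le> norm (toLsq g)"
    using x by (simp add: mult_left_le_one_le)
  finally show ?thesis .
qed

lemma primitive_add: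
  assumes "sq_integrable g" "sq_integrable h"
  shows "primitive (\<lambda>x. g x + h x) = (\<lambda>x. primitive g x + primitive h x)"
proof -
  have "zero_ext (\<lambda>x. g x + h x) = (\<lambda>x. zero_ext g x + zero_ext h x)"
    by (auto simp: zero_ext_def)
  then show ?thesis
    by (intro ext) (simp add: primitive_def Henstock_Kurzweil_Integration.integral_add
        zero_ext_integrable_on assms)
qed

lemma primitive2_add:
  assumes "sq_integrable g" "sq_integrable h"
  shows "primitive2 (\<lambda>x. g x + h x) = (\<lambda>x. primitive2 g x + primitive2 h x)"
  by (intro ext) (simp add: primitive2_def primitive_add assms
      Henstock_Kurzweil_Integration.integral_add primitive_integrable_on)

lemma primitive_scaleR: "primitive (\<lambda>x. c *\<^sub>R g x) = (\<lambda>x. c *\<^sub>R primitive g x)"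
proof -
  have "zero_ext (\<lambda>x. c *\<^sub>R g x) = (\<lambda>x. c *\<^sub>R zero_ext g x)"
    by (auto simp: zero_ext_def)
  then show ?thesis
    by (intro ext) (simp only: primitive_def Henstock_Kurzweil_Integration.integral_cmul)
qed

lemma primitive2_scaleR: "primitive2 (\<lambda>x. c *\<^sub>R g x) = (\<lambda>x. c *\<^sub>R primitive2 g x)"
  by (intro ext) (simp only: primitive2_def primitive_scaleR Henstock_Kurzweil_Integration.integral_cmul)

lemma primitive_cong_AE:
  assumes "AE x in leb01. g x = h x"
  shows "primitive g = primitive h"
proof
  fix x
  obtain N where N: "negligible N" "\<And>x. x \<in> {0<..<1} - N \<Longrightarrow> g x = h x"
    using assms unfolding AE_leb01_iff_negligible by blast
  show "primitive g x = primitive h x"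
    unfolding primitive_def
    by (rule integral_spike[OF N(1)]) (use N(2) in \<open>auto simp: zero_ext_def\<close>)
qed

lemma primitive2_cong_AE: "AE x in leb01. g x = h x \<Longrightarrow> primitive2 g = primitive2 h"
  using primitive_cong_AE[of g h] by (intro ext) (simp add: primitive2_def)

lemma AE_has_vector_derivative_primitive:
  assumes "sq_integrable g"
  shows "AE x in leb01. (primitive g has_vector_derivative g x) (at x)"
proof -
  obtain N where N: "negligible N" "\<And>a x. x \<notin> N \<Longrightarrow> a < x \<Longrightarrow>
      ((\<lambda>y. integral {a..y} (zero_ext g)) has_vector_derivative zero_ext g x) (at x)"
    using AE_derivative_indefinite_integral[OF zero_ext_integrable_on[OF assms]] by metis
  have "(primitive g has_vector_derivative g x) (at x)" if "x \<in> {0<..<1} - N" for x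
    using N(2)[of x 0] that by (simp add: primitive_def[abs_def] zero_ext_def)
  with N(1) show ?thesis
    unfolding AE_leb01_iff_negligible by blast
qed

lemma has_vector_derivative_primitive2:
  assumes "sq_integrable g" "x \<in> {0..1}"
  shows "(primitive2 g has_vector_derivative primitive g x) (at x within {0..1})"
  unfolding primitive2_def[abs_def]
  using assms by (intro integral_has_vector_derivative continuous_on_primitive)

text \<open>A continuous \<open>f'\<close> is square-integrable on a compact interval and the
  increments of \<open>f\<close> are its integrals, so the increment criterion applies.\<close>

lemma abs_continuous_on_C1:
  assumes cont: "continuous_on {c..d} f'"
    and der: "\<And>x. x \<in> {c..d} \<Longrightarrow> (f has_vector_derivative f' x) (at x within {c..d})"
  shows "abs_continuous_on c d f"
proof (rule abs_continuous_on_if_increments_le)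
  show "f' integrable_on {c..d}" "(\<lambda>x. (cmod (f' x))\<^sup>2) integrable_on {c..d}"
    using cont by (auto intro!: integrable_continuous_real continuous_intros)
  fix s t assume st: "c \<le> s" "s \<le> t" "t \<le> d"
  have "(f' has_integral f t - f s) {s..t}"
    using st by (intro fundamental_theorem_of_calculus has_vector_derivative_within_subset[OF der]) auto
  then show "cmod (f t - f s) \<le> cmod (integral {s..t} f')"
    by (simp add: integral_unique)
qed

text \<open>The affine part of the solution of \<open>- f'' = g\<close> is determined by the boundary conditions as
  a linear function of \<open>f' 0 - f' 1\<close> and \<open>f 0 + f' 0 - f 1\<close>.\<close>

lemma boundary_cond_affine:
  assumes "admissible K"
  obtains p q r s :: real where "\<And>f f' I1 I2. f 1 = f 0 + f' 0 - I2 \<Longrightarrow> f' 1 = f' 0 - I1 \<Longrightarrow>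
    boundary_cond K f f' \<longleftrightarrow> f 0 = p *\<^sub>R I1 + q *\<^sub>R I2 \<and> f' 0 = r *\<^sub>R I1 + s *\<^sub>R I2"
proof (cases K)
  case Tmin
  show thesis by (rule that[of 0 0 0 1]) (auto simp: Tmin algebra_simps)
next
  case T0
  show thesis by (rule that[of 0 0 1 0]) (auto simp: T0 algebra_simps)
next
  case T1
  show thesis by (rule that[of 0 1 0 0]) (auto simp: T1 algebra_simps)
next
  case (Tomega \<omega>)
  with assms have "\<omega> \<noteq> 1" "\<omega> - 1 \<noteq> 0" by auto
  then have \<omega>: "complex_of_real \<omega> - 1 \<noteq> 0"
    by (metis of_real_1 of_real_diff of_real_eq_0_iff)
  show thesis
  \<comment> \<open>With \<open>w\<close> for \<omega> - 1, the boundary conditions become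
    \<open>w * f 0 = f' 0 - I2\<close> and \<open>w * f' 0 = (w + 1) * I1\<close>. This triangular
    system is solved by dividing by \<open>w\<close>, which is where \<omega> differing from 1
    enters.\<close>
  proof (rule that[of "\<omega> / (\<omega> - 1)\<^sup>2" "- 1 / (\<omega> - 1)" "\<omega> / (\<omega> - 1)" 0])
    fix f f' :: "real \<Rightarrow> complex" and I1 I2
    assume 1: "f 1 = f 0 + f' 0 - I2" "f' 1 = f' 0 - I1"
    define w where "w = complex_of_real \<omega> - 1"
    have w: "w \<noteq> 0" "complex_of_real \<omega> = w + 1"
      using \<omega> by (simp_all add: w_def)
    have "f 1 = complex_of_real \<omega> * f 0 \<and> complex_of_real \<omega> * f' 1 = f' 0 \<longleftrightarrow>
        w * f 0 = f' 0 - I2 \<and> w * f' 0 = (w + 1) * I1"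
      unfolding 1 w(2) by (auto simp: algebra_simps)
    also have "\<dots> \<longleftrightarrow> f 0 = ((w + 1) / w * I1 - I2) / w \<and> f' 0 = (w + 1) / w * I1"
      using w(1) by (auto simp: nonzero_eq_divide_eq nonzero_divide_eq_eq mult.commute[of w])
    also have "((w + 1) / w * I1 - I2) / w = (w + 1) / w\<^sup>2 * I1 + (- 1 / w) * I2"
      using w(1) by (simp add: field_simps power2_eq_square)
    finally show "boundary_cond K f f' \<longleftrightarrow>
        f 0 = (\<omega> / (\<omega> - 1)\<^sup>2) *\<^sub>R I1 + (- 1 / (\<omega> - 1)) *\<^sub>R I2 \<and> f' 0 = (\<omega> / (\<omega> - 1)) *\<^sub>R I1 + 0 *\<^sub>R I2"
      by (simp add: Tomega scaleR_conv_of_real w_def)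
  qed
qed

text \<open>The candidate \<open>sol g\<close> has second derivative \<open>- g\<close> a.e., and
  its affine part \<open>f0 g + x *\<^sub>R f1 g\<close> is fixed by the boundary conditions.
  Conversely, two integrations show that every pair in the graph arises in this way; this makes the
  converse of the graph exactly the graph of \<open>L\<close>.\<close>

lemma boundedly_invertible_TstarT:
  assumes "admissible K"
  shows "boundedly_invertible (TstarT K)"
proof -
  obtain p q r s :: real where bc: "\<And>f f' I1 I2. f 1 = f 0 + f' 0 - I2 \<Longrightarrow> f' 1 = f' 0 - I1 \<Longrightarrow>
    boundary_cond K f f' \<longleftrightarrow> f 0 = p *\<^sub>R I1 + q *\<^sub>R I2 \<and> f' 0 = r *\<^sub>R I1 + s *\<^sub>R I2"
    using boundary_cond_affine[OF assms] by metis
  define f0 where "f0 g = p *\<^sub>R primitive g 1 + q *\<^sub>R primitive2 g 1" for g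
  define f1 where "f1 g = r *\<^sub>R primitive g 1 + s *\<^sub>R primitive2 g 1" for g
  define sol where "sol g x = f0 g + x *\<^sub>R f1 g - primitive2 g x" for g x
  define sol' where "sol' g x = f1 g - primitive g x" for g x
  have sol_deriv: "(sol g has_vector_derivative sol' g x) (at x within {0..1})"
    if "sq_integrable g" "x \<in> {0..1}" for g x
    unfolding sol_def sol'_def
    by (auto intro!: derivative_eq_intros has_vector_derivative_primitive2 that)
  have sol'_cont: "continuous_on {0..1} (sol' g)" if "sq_integrable g" for g
    unfolding sol'_def by (intro continuous_intros continuous_on_primitive that)
  have sol_meas: "sol g \<in> borel_measurable leb01" if "sq_integrable g" for g
  proof -
    have "continuous_on {0..1} (sol g)"
      using sol_deriv[OF that] has_vector_derivative_continuous continuous_on_eq_continuous_within by blast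
    then have "continuous_on {0<..<1} (sol g)"
      by (rule continuous_on_subset) auto
    then show ?thesis
      by (rule continuous_imp_measurable_on_sets_lebesgue) simp
  qed
  \<comment> \<open>The four coefficients bound the affine part on [0,1], the 1 accounts for
    \<open>primitive2 g\<close>.\<close>
  define C where "C = \<bar>p\<bar> + \<bar>q\<bar> + \<bar>r\<bar> + \<bar>s\<bar> + 1"
  have sol_le: "cmod (sol g x) \<le> C * norm (toLsq g)" if g: "sq_integrable g" and x: "x \<in> {0..1}" for g x
  proof -
    let ?n = "norm (toLsq g)"
    have lin: "cmod (c *\<^sub>R primitive g 1 + c' *\<^sub>R primitive2 g 1) \<le> (\<bar>c\<bar> + \<bar>c'\<bar>) * ?n" for c c'
      using norm_primitive_le[OF g, of 1] norm_primitive2_le[OF g, of 1]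
      by (intro order_trans[OF norm_triangle_ineq]) (auto simp: algebra_simps intro!: add_mono mult_left_mono)
    have "cmod (x *\<^sub>R f1 g) \<le> cmod (f1 g)"
      using x by (simp add: mult_left_le_one_le)
    moreover have "cmod (sol g x) \<le> cmod (f0 g) + cmod (x *\<^sub>R f1 g) + cmod (primitive2 g x)"
      unfolding sol_def by (rule order_trans[OF norm_triangle_ineq4 add_right_mono[OF norm_triangle_ineq]])
    ultimately have "cmod (sol g x) \<le> (\<bar>p\<bar> + \<bar>q\<bar>) * ?n + (\<bar>r\<bar> + \<bar>s\<bar>) * ?n + ?n"
      using lin[of p q] lin[of r s] norm_primitive2_le[OF g x] unfolding f0_def f1_def by linarith
    then show ?thesis
      by (simp add: C_def algebra_simps)
  qed
  have "0 \<le> C" by (simp add: C_def)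
  have sol_sq: "sq_integrable (sol g)" and norm_sol: "norm (toLsq (sol g)) \<le> C * norm (toLsq g)"
    if g: "sq_integrable g" for g
    using sq_integrable_bounded[OF sol_meas[OF g], of "C * norm (toLsq g)"] sol_le[OF g] \<open>0 \<le> C\<close> by auto
  have sol_add: "sol (\<lambda>x. g x + h x) = (\<lambda>x. sol g x + sol h x)" if "sq_integrable g" "sq_integrable h" for g h
    using that by (simp add: fun_eq_iff sol_def f0_def f1_def primitive_add primitive2_add algebra_simps)
  have sol_scaleR: "sol (\<lambda>x. c *\<^sub>R g x) = (\<lambda>x. c *\<^sub>R sol g x)" for c g
    unfolding fun_eq_iff sol_def f0_def f1_def primitive_scaleR primitive2_scaleR
    by (simp add: scaleR_add_right scaleR_diff_right mult.commute mult.left_commute)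
  \<comment> \<open>The choice of representative does not matter: primitives of a.e. equal functions
    are equal everywhere.\<close>
  define L where "L u = toLsq (sol (rep_Lsq u))" for u
  have L: "L (toLsq g) = toLsq (sol g)" if "sq_integrable g" for g
  proof -
    have "AE x in leb01. rep_Lsq (toLsq g) x = g x"
      using rep_Lsq_toLsq[OF that] by (simp add: Lsq_rel_def)
    note cong = primitive_cong_AE[OF this] primitive2_cong_AE[OF this]
    have "sol (rep_Lsq (toLsq g)) = sol g"
      by (simp add: fun_eq_iff sol_def f0_def f1_def cong)
    then show ?thesis by (simp add: L_def)
  qed
  have "bounded_linear L"
  proof (rule bounded_linear_intro[where K = C])
    fix u v :: Lsq and c :: real
    obtain g h where g: "sq_integrable g" "u = toLsq g" and h: "sq_integrable h" "v = toLsq h"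
      using obtain_toLsq by metis
    show "L (u + v) = L u + L v"
      using g h by (simp add: L sol_add sol_sq sq_integrable_add flip: toLsq_add)
    show "L (c *\<^sub>R u) = c *\<^sub>R L u"
      using g by (simp add: L sol_scaleR sol_sq sq_integrable_scaleR flip: toLsq_scaleR)
    show "norm (L u) \<le> norm u * C"
      using norm_sol[OF g(1)] by (simp add: g L mult.commute)
  qed
  then have BL: "blinfun_apply (Blinfun L) = L"
    by (rule bounded_linear_Blinfun_apply)
  have mem: "(L v, v) \<in> TstarT K" for v
  proof -
    obtain g where g: "sq_integrable g" "v = toLsq g"
      using obtain_toLsq by metis
    have ac': "abs_continuous_on 0 1 (sol' g)"
    proof (rule abs_continuous_on_if_increments_le)
      show "cmod (sol' g t - sol' g s) \<le> cmod (integral {s..t} (zero_ext g))"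
        if "0 \<le> s" "s \<le> t" "t \<le> 1" for s t
        unfolding primitive_diff[OF g(1) that(1,2), symmetric] by (simp add: sol'_def norm_minus_commute)
    qed (intro zero_ext_integrable_on sq_norm_zero_ext_integrable_on g)+
    have ac: "abs_continuous_on 0 1 (sol g)"
      by (rule abs_continuous_on_C1[OF sol'_cont[OF g(1)] sol_deriv[OF g(1)]])
    have ae: "AE x in leb01. (sol' g has_vector_derivative - g x) (at x)"
      using AE_has_vector_derivative_primitive[OF g(1)]
      by eventually_elim (auto simp: sol'_def[abs_def] intro!: derivative_eq_intros)
    have "boundary_cond K (sol g) (sol' g)"
      by (subst bc[where ?I1.0 = "primitive g 1" and ?I2.0 = "primitive2 g 1"]) (auto simp: sol_def sol'_def f0_def f1_def)
    \<comment> \<open>The double negation matches the shape of \<open>TstarT\<close>, whose second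
      component is \<open>- f''\<close>, here with \<open>f'' = - g\<close>.\<close>
    then have "(toLsq (sol g), toLsq (\<lambda>x. - (- g x))) \<in> TstarT K"
      unfolding TstarT_def mem_Collect_eq
      by (intro exI[of _ "sol g"] exI[of _ "sol' g"] exI[of _ "\<lambda>x. - g x"] conjI ballI refl
          ac ac' ae sol_deriv sol_sq sq_integrable_minus g(1))
    then show ?thesis
      using L g by simp
  qed
  have uniq: "L v = u" if uv: "(u, v) \<in> TstarT K" for u v
  proof -
    obtain f f' f'' where u: "u = toLsq f" and v: "v = toLsq (\<lambda>x. - f'' x)"
      and ac': "abs_continuous_on 0 1 f'"
      and der: "\<And>x. x \<in> {0..1} \<Longrightarrow> (f has_vector_derivative f' x) (at x within {0..1})"
      and ae: "AE x in leb01. (f' has_vector_derivative f'' x) (at x)"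
      and sq: "sq_integrable f" "sq_integrable f''"
      and bcf: "boundary_cond K f f'"
      using uv unfolding TstarT_def by blast
    define g where "g x = - f'' x" for x
    have g: "sq_integrable g"
      unfolding g_def using sq(2) by (rule sq_integrable_minus)
    obtain N where N: "negligible N" "\<And>x. x \<in> {0<..<1} - N \<Longrightarrow> (f' has_vector_derivative f'' x) (at x)"
      using ae unfolding AE_leb01_iff_negligible by blast
    have f': "f' x = f' 0 - primitive g x" if x: "x \<in> {0..1}" for x
    proof -
      have "((\<lambda>x. - zero_ext g x) has_integral f' x - f' 0) {0..x}"
      proof (rule has_integral_abs_continuous_on)
        show "abs_continuous_on 0 x f'"
          using x by (intro abs_continuous_on_subset[OF ac']) auto
        \<comment> \<open>The a.e. statement gives nothing at the end points, where moreover
          \<open>zero_ext g\<close> is 0.\<close>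
        show "negligible (N \<union> {0, 1})"
          using N(1) by (intro negligible_Un) auto
        show "(f' has_vector_derivative - zero_ext g y) (at y within {0..x})"
          if "y \<in> {0..x} - (N \<union> {0, 1})" for y
        proof -
          have y: "y \<in> {0<..<1} - N" using that x by auto
          then have "- zero_ext g y = f'' y" by (simp add: zero_ext_def g_def)
          then show ?thesis using N(2)[OF y] by (simp add: has_vector_derivative_at_within)
        qed
      qed (use x in auto)
      from has_integral_neg[OF this] have "primitive g x = - (f' x - f' 0)"
        unfolding primitive_def by (intro integral_unique) simp
      then show ?thesis by simp
    qed
    have f: "f x = f 0 + x *\<^sub>R f' 0 - primitive2 g x" if x: "x \<in> {0..1}" for x
    proof -
      \<comment> \<open>The function \<open>f\<close> is differentiable at every point of [0,1], so
        the ordinary fundamental theorem suffices here; only the step from \<open>f''\<close> to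
        \<open>f'\<close> needs absolute continuity.\<close>
      have "(f' has_integral f x - f 0) {0..x}"
        using x by (intro fundamental_theorem_of_calculus has_vector_derivative_within_subset[OF der]) auto
      then have "f x - f 0 = integral {0..x} f'"
        by (simp add: integral_unique)
      also have "\<dots> = integral {0..x} (\<lambda>t. f' 0 - primitive g t)"
        by (rule Henstock_Kurzweil_Integration.integral_cong, rule f') (use x in auto)
      also have "\<dots> = x *\<^sub>R f' 0 - primitive2 g x"
        unfolding primitive2_def using x
        by (subst Henstock_Kurzweil_Integration.integral_diff) (auto intro: primitive_integrable_on g)
      finally show ?thesis by (simp add: algebra_simps)
    qed
    have "f 0 = f0 g \<and> f' 0 = f1 g"
      unfolding f0_def f1_def
      by (rule bc[THEN iffD1, OF _ _ bcf]) (use f[of 1] f'[of 1] in auto)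
    then have "sol g x = f x" if "x \<in> {0<..<1}" for x
      using f[of x] that by (simp add: sol_def)
    then have "Lsq_rel (sol g) f"
      unfolding Lsq_rel_def using sol_sq[OF g] sq(1) by (auto intro!: AE_I2)
    then have "toLsq (sol g) = toLsq f"
      by (rule toLsq_eq)
    then show ?thesis
      using L[OF g] u v by (simp add: g_def[abs_def])
  qed
  have "is_bounded_inverse (Blinfun L) (TstarT K)"
    unfolding is_bounded_inverse_def BL using mem uniq by blast
  then show ?thesis
    unfolding boundedly_invertible_def by blast
qed

section \<open>Power series with vector coefficients\<close>

definition vec_powser :: "(nat \<Rightarrow> 'a::banach) \<Rightarrow> real \<Rightarrow> 'a" where
  "vec_powser a x = (\<Sum>n. x ^ n *\<^sub>R a n)"

definition vec_diffs :: "(nat \<Rightarrow> 'a::real_vector) \<Rightarrow> nat \<Rightarrow> 'a" where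
  "vec_diffs a n = real (Suc n) *\<^sub>R a (Suc n)"

text \<open>Phrased through the scalar series of norms, so that results on real power series apply,
  in particular that termwise differentiation keeps the radius.\<close>

definition powser_radius_ge :: "real \<Rightarrow> (nat \<Rightarrow> 'a::banach) \<Rightarrow> bool" where
  "powser_radius_ge r a \<longleftrightarrow> (\<forall>x. \<bar>x\<bar> < r \<longrightarrow> summable (\<lambda>n. norm (a n) * x ^ n))"

lemma powser_radius_ge_sums:
  assumes "powser_radius_ge r a" "\<bar>x\<bar> < r"
  shows "(\<lambda>n. x ^ n *\<^sub>R a n) sums vec_powser a x"
proof -
  have "summable (\<lambda>n. norm (x ^ n *\<^sub>R a n))"
    using assms(1)[unfolded powser_radius_ge_def, rule_format, of "\<bar>x\<bar>"] assms(2)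
    by (simp add: mult.commute power_abs)
  then show ?thesis
    unfolding vec_powser_def by (rule summable_sums[OF summable_norm_cancel])
qed

lemma powser_radius_ge_vec_diffs:
  assumes "powser_radius_ge r a"
  shows "powser_radius_ge r (vec_diffs a)"
  unfolding powser_radius_ge_def
proof (intro allI impI)
  fix x :: real
  assume "\<bar>x\<bar> < r"
  with assms have "summable (\<lambda>n. diffs (\<lambda>n. norm (a n)) n * x ^ n)"
    by (intro termdiff_converges[where K = r]) (auto simp: powser_radius_ge_def)
  then show "summable (\<lambda>n. norm (vec_diffs a n) * x ^ n)"
    by (simp add: diffs_def vec_diffs_def)
qed

text \<open>The derived series has the same radius, hence converges uniformly on a smaller ball by
  the M-test; this licenses termwise differentiation. The radius \<open>s\<close> lies strictly
  between the modulus of \<open>x\<close> and \<open>r\<close> so that the terms at \<open>s\<close>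
  majorize the derived series on the ball.\<close>

lemma has_vector_derivative_vec_powser:
  fixes a :: "nat \<Rightarrow> 'a::banach"
  assumes a: "powser_radius_ge r a" and x: "\<bar>x\<bar> < r"
  shows "(vec_powser a has_vector_derivative vec_powser (vec_diffs a) x) (at x)"
proof -
  obtain s where s: "\<bar>x\<bar> < s" "s < r"
    using dense[OF x] by blast
  define S where "S = ball (0::real) s"
  define f' where "f' n y h = (h * (real n * y ^ (n - 1))) *\<^sub>R a n" for n and y h :: real
  have da: "powser_radius_ge r (vec_diffs a)"
    using a by (rule powser_radius_ge_vec_diffs)
  have "uniform_limit S (\<lambda>n y. \<Sum>i<n. y ^ i *\<^sub>R vec_diffs a i)
      (\<lambda>y. \<Sum>n. y ^ n *\<^sub>R vec_diffs a n) sequentially"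
  proof (rule Weierstrass_m_test)
    show "summable (\<lambda>n. norm (vec_diffs a n) * s ^ n)"
      using da[unfolded powser_radius_ge_def, rule_format, of s] s by simp
    fix n y assume "y \<in> S"
    then have "\<bar>y ^ n\<bar> \<le> s ^ n"
      unfolding power_abs by (intro power_mono) (simp_all add: S_def)
    then show "norm (y ^ n *\<^sub>R vec_diffs a n) \<le> norm (vec_diffs a n) * s ^ n"
      by (simp add: mult.commute mult_left_mono mult_right_mono)
  qed
  note unif = uniform_limitD[OF this, folded vec_powser_def]
  have f'_Suc: "f' (Suc i) y h = h *\<^sub>R y ^ i *\<^sub>R vec_diffs a i" for i y h
    by (simp add: f'_def vec_diffs_def mult.commute[of "real (Suc i)"] mult.assoc del: of_nat_Suc)
  \<comment> \<open>The constant term has derivative 0, so \<open>Suc n\<close> differentiated terms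
    make only \<open>n\<close> terms of the derived series. This shift is why the limit is later
    taken along \<open>Suc n\<close>.\<close>
  have partial: "(\<Sum>i<Suc n. f' i y h) = h *\<^sub>R (\<Sum>i<n. y ^ i *\<^sub>R vec_diffs a i)" for n y h
    by (subst sum.lessThan_Suc_shift) (simp add: scaleR_sum_right f'_Suc f'_def[of 0])
  have "\<exists>g. \<forall>y\<in>S. (\<lambda>n. y ^ n *\<^sub>R a n) sums g y \<and>
      (g has_derivative (\<lambda>h. h *\<^sub>R vec_powser (vec_diffs a) y)) (at y within S)"
  proof (rule has_derivative_series[where f = "\<lambda>n y. y ^ n *\<^sub>R a n" and f' = f'
        and g' = "\<lambda>y h. h *\<^sub>R vec_powser (vec_diffs a) y" and x = 0 and l = "vec_powser a 0"])
    show "((\<lambda>y. y ^ n *\<^sub>R a n) has_derivative f' n y) (at y within S)" for n y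
      unfolding f'_def
      by (auto intro!: derivative_eq_intros simp: fun_eq_iff)
    show "\<forall>\<^sub>F n in sequentially. \<forall>y\<in>S. \<forall>h.
        norm ((\<Sum>i<n. f' i y h) - h *\<^sub>R vec_powser (vec_diffs a) y) \<le> e * norm h" if "0 < e" for e
    proof (rule eventually_sequentially_Suc[THEN iffD1])
      show "\<forall>\<^sub>F n in sequentially. \<forall>y\<in>S. \<forall>h.
          norm ((\<Sum>i<Suc n. f' i y h) - h *\<^sub>R vec_powser (vec_diffs a) y) \<le> e * norm h"
        using unif[OF that]
      proof eventually_elim
        case (elim n)
        show ?case
        proof (intro ballI allI)
          fix y h :: real assume "y \<in> S"
          with elim have "norm ((\<Sum>i<n. y ^ i *\<^sub>R vec_diffs a i) - vec_powser (vec_diffs a) y) \<le> e"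
            by (simp add: dist_norm less_imp_le)
          then show "norm ((\<Sum>i<Suc n. f' i y h) - h *\<^sub>R vec_powser (vec_diffs a) y) \<le> e * norm h"
            unfolding partial scaleR_diff_right[symmetric] norm_scaleR
            by (simp add: mult.commute[of e] mult_left_mono)
        qed
      qed
    qed
    show "(\<lambda>n. 0 ^ n *\<^sub>R a n) sums vec_powser a 0"
      by (rule powser_radius_ge_sums[OF a]) (use x in simp)
    show "convex S" "0 \<in> S"
      using s(1) by (simp_all add: S_def)
  qed
  then obtain g where g: "\<And>y. y \<in> S \<Longrightarrow> (\<lambda>n. y ^ n *\<^sub>R a n) sums g y"
      "\<And>y. y \<in> S \<Longrightarrow> (g has_derivative (\<lambda>h. h *\<^sub>R vec_powser (vec_diffs a) y)) (at y within S)"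
    by blast
  have "g y = vec_powser a y" if "y \<in> S" for y
    unfolding vec_powser_def using sums_unique[OF g(1)[OF that]] .
  note eq = this
  have S: "x \<in> S" "open S"
    using s(1) by (simp_all add: S_def)
  have "(vec_powser a has_derivative (\<lambda>h. h *\<^sub>R vec_powser (vec_diffs a) x)) (at x within S)"
    by (rule has_derivative_transform[OF S(1) _ g(2)[OF S(1)]]) (simp add: eq)
  then show ?thesis
    unfolding at_within_open[OF S] has_vector_derivative_def .
qed

lemma vec_powser_0: "vec_powser a 0 = a 0"
proof -
  have "(\<lambda>n. 0 ^ n *\<^sub>R a n) sums (0 ^ 0 *\<^sub>R a 0)"
    using sums_finite[of "{0}" "\<lambda>n. 0 ^ n *\<^sub>R a n"] by simp
  then show ?thesis
    by (simp add: vec_powser_def sums_iff)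
qed

section \<open>Iterated derivatives and Taylor coefficients\<close>

lemma vec_diffs_funpow: "(vec_diffs ^^ n) a k = (fact (n + k) / fact k) *\<^sub>R a (n + k)"
proof (induction n arbitrary: k)
  case (Suc n)
  have "real (Suc k) * (fact (n + Suc k) / fact (Suc k)) = fact (Suc n + k) / fact k"
    unfolding fact_Suc[of k] add_Suc_right add_Suc by simp
  then show ?case
    using Suc[of "Suc k"] by (simp add: vec_diffs_def)
qed simp

lemma nth_vector_derivative_Suc:
  "nth_vector_derivative (Suc n) F = (\<lambda>t. vector_derivative (nth_vector_derivative n F) (at t))"
  by (simp add: nth_vector_derivative_def)

text \<open>Induction on \<open>n\<close>: to differentiate once more, the previous derivative must
  be known near the point and not only at it, hence the equality on the whole interval. The second
  conclusion certifies that the derivative really exists.\<close>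

lemma nth_vector_derivative_vec_powser:
  fixes a :: "nat \<Rightarrow> 'a::banach"
  assumes a: "powser_radius_ge r a" and F: "\<And>x. \<bar>x\<bar> < r \<Longrightarrow> F x = vec_powser a x"
    and x: "\<bar>x\<bar> < r"
  shows "nth_vector_derivative n F x = vec_powser ((vec_diffs ^^ n) a) x"
    and "(nth_vector_derivative n F has_vector_derivative
        vec_powser ((vec_diffs ^^ Suc n) a) x) (at x)"
proof -
  have rad: "powser_radius_ge r ((vec_diffs ^^ n) a)" for n
    using a by (induction n) (auto intro: powser_radius_ge_vec_diffs)
  have der: "(G has_vector_derivative vec_powser ((vec_diffs ^^ Suc n) a) x) (at x)"
    if G: "\<And>x. \<bar>x\<bar> < r \<Longrightarrow> G x = vec_powser ((vec_diffs ^^ n) a) x" and x: "\<bar>x\<bar> < r" for G n x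
  proof (rule has_vector_derivative_transform_within_open[where S = "ball 0 r"])
    show "(vec_powser ((vec_diffs ^^ n) a) has_vector_derivative
        vec_powser ((vec_diffs ^^ Suc n) a) x) (at x)"
      using has_vector_derivative_vec_powser[OF rad x] by simp
  qed (use that in auto)
  have *: "nth_vector_derivative n F x = vec_powser ((vec_diffs ^^ n) a) x" if "\<bar>x\<bar> < r" for x
    using that
  proof (induction n arbitrary: x)
    case 0
    then show ?case by (simp add: nth_vector_derivative_def F)
  next
    case (Suc n)
    then show ?case
      unfolding nth_vector_derivative_Suc by (intro vector_derivative_at der)
  qed
  from * x show "nth_vector_derivative n F x = vec_powser ((vec_diffs ^^ n) a) x" by blast
  from der[OF * x] show "(nth_vector_derivative n F has_vector_derivative
        vec_powser ((vec_diffs ^^ Suc n) a) x) (at x)" .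
qed

lemma nth_vector_derivative_vec_powser_0:
  fixes a :: "nat \<Rightarrow> 'a::banach"
  assumes "powser_radius_ge r a" "\<And>x. \<bar>x\<bar> < r \<Longrightarrow> F x = vec_powser a x" "0 < r"
  shows "nth_vector_derivative n F 0 = fact n *\<^sub>R a n"
proof -
  have "nth_vector_derivative n F 0 = vec_powser ((vec_diffs ^^ n) a) 0"
    by (rule nth_vector_derivative_vec_powser(1)[OF assms(1,2)]) (use assms(3) in simp_all)
  also have "\<dots> = (vec_diffs ^^ n) a 0"
    by (rule vec_powser_0)
  also have "\<dots> = fact n *\<^sub>R a n"
    unfolding vec_diffs_funpow by simp
  finally show ?thesis .
qed

section \<open>Expansion of the resolvent\<close>

interpretation blinfun_compose: bounded_bilinear "(o\<^sub>L)"
  by (rule bounded_bilinear_blinfun_compose)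

lemma blinfun_compose_assoc: "(a o\<^sub>L b) o\<^sub>L c = a o\<^sub>L (b o\<^sub>L c)"
  by (rule blinfun_eqI) simp

lemma blinfun_compose_id [simp]: "a o\<^sub>L id_blinfun = a" "id_blinfun o\<^sub>L a = a"
  by (rule blinfun_eqI; simp)+

lemmas blinfun_compose_algebra = blinfun_compose.add_left blinfun_compose.add_right
  blinfun_compose.diff_left blinfun_compose.diff_right
  blinfun_compose.minus_left blinfun_compose.minus_right
  blinfun_compose.scaleR_left blinfun_compose.scaleR_right

section \<open>Neumann series and the inverse of the pencil\<close>

text \<open>Multiplying the sum of the powers of \<open>- T\<close> by \<open>- T\<close> drops its
  first term. The powers are built by composition on the left; \<open>P_right\<close> supplies the
  same on the right, so that the inverse is two-sided.\<close>

lemma Neumann_inverse: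
  fixes T :: "'a::banach \<Rightarrow>\<^sub>L 'a"
  assumes T: "norm T < 1"
  obtains S where "(id_blinfun + T) o\<^sub>L S = id_blinfun" "S o\<^sub>L (id_blinfun + T) = id_blinfun"
proof -
  define P where "P n = ((\<lambda>X. (- T) o\<^sub>L X) ^^ n) id_blinfun" for n
  have P0: "P 0 = id_blinfun" and P_left: "P (Suc n) = (- T) o\<^sub>L P n" for n
    by (simp_all add: P_def)
  have P_right: "P (Suc n) = P n o\<^sub>L (- T)" for n
  proof (induction n)
    case (Suc n)
    have "P (Suc (Suc n)) = (- T) o\<^sub>L (P n o\<^sub>L (- T))"
      by (simp only: P_left[of "Suc n"] Suc)
    then show ?case
      by (simp only: P_left[of n] blinfun_compose_assoc)
  qed (simp add: P0 P_left)
  have "norm (P n) \<le> norm T ^ n" for n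
  proof (induction n)
    case 0
    show ?case by (simp add: P0 norm_blinfun_id_le)
  next
    case (Suc n)
    have "norm (P (Suc n)) \<le> norm T * norm (P n)"
      using norm_blinfun_compose[of "- T" "P n"] by (simp add: P_left)
    also have "\<dots> \<le> norm T ^ Suc n"
      using Suc by (simp add: mult_left_mono)
    finally show ?case .
  qed
  then have P: "summable P"
    using T by (intro summable_comparison_test'[OF summable_geometric[of "norm T"]]) auto
  have left: "(- T) o\<^sub>L suminf P = suminf P - id_blinfun"
    using bounded_linear.suminf[OF blinfun_compose.bounded_linear_right P, of "- T"]
      suminf_split_head[OF P] by (simp add: P_left P0)
  have right: "suminf P o\<^sub>L (- T) = suminf P - id_blinfun"
    using bounded_linear.suminf[OF blinfun_compose.bounded_linear_left P, of "- T"]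
      suminf_split_head[OF P] by (simp add: P_right P0)
  show thesis
    by (rule that[of "suminf P"])
      (use left right in \<open>simp_all add: blinfun_compose_algebra algebra_simps\<close>)
qed

lemma inverse_op_eq:
  assumes "is_bounded_inverse B A" shows "inverse_op A = B"
  unfolding inverse_op_def
proof (rule the_equality[where P = "\<lambda>B. is_bounded_inverse B A", OF assms])
  fix B' assume "is_bounded_inverse B' A"
  with assms show "B' = B"
    by (intro blinfun_eqI) (auto simp: is_bounded_inverse_def)
qed

text \<open>Writing \<open>u = B w\<close> parametrizes the domain by all of \<open>Lsq\<close>, and
  the pencil becomes the set of pairs of \<open>B w\<close> and \<open>(id_blinfun + T) w\<close>.
  The right inverse property of \<open>S\<close> then provides a \<open>w\<close> for each
  \<open>v\<close>, and the left one shows that it is the only one.\<close>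

lemma is_bounded_inverse_pencil:
  assumes B: "is_bounded_inverse B (TstarT K)"
    and S: "(id_blinfun + T) o\<^sub>L S = id_blinfun" "S o\<^sub>L (id_blinfun + T) = id_blinfun"
    and T: "T = \<zeta>\<^sup>2 *\<^sub>R B + \<zeta> *\<^sub>R (mult_op \<alpha> o\<^sub>L B)"
  shows "is_bounded_inverse (B o\<^sub>L S) (pencil K \<alpha> \<zeta>)"
proof -
  have B_iff: "(u, w) \<in> TstarT K \<longleftrightarrow> u = blinfun_apply B w" for u w
    using B unfolding is_bounded_inverse_def by metis
  have S1: "blinfun_apply S w + blinfun_apply T (blinfun_apply S w) = w" for w
    using arg_cong[OF S(1), of "\<lambda>X. blinfun_apply X w"] by (simp add: blinfun.add_left)
  have S2: "blinfun_apply S (w + blinfun_apply T w) = w" for w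
    using arg_cong[OF S(2), of "\<lambda>X. blinfun_apply X w"] by (simp add: blinfun.add_left)
  have pencil: "(u, v) \<in> pencil K \<alpha> \<zeta> \<longleftrightarrow> (\<exists>w. u = blinfun_apply B w \<and> v = w + blinfun_apply T w)" for u v
    unfolding pencil_def T B_iff by (auto simp: blinfun.add_left blinfun.scaleR_left add.assoc)
  show ?thesis
    unfolding is_bounded_inverse_def pencil by (metis S1 S2 blinfun_apply_blinfun_compose)
qed

text \<open>Linearity in the symbol is not automatic, since \<open>mult_op\<close> is a
  \<open>Blinfun\<close> that is meaningful only for essentially bounded symbols; the shifted symbol
  gets its own bound. This splits the factor \<open>2 * \<zeta> + \<alpha>\<close> of
  \<open>R\<close>.\<close>

lemma mult_op_shift:
  assumes \<alpha>: "\<alpha> \<in> borel_measurable leb01" and B: "AE x in leb01. \<bar>\<alpha> x\<bar> \<le> B"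
  shows "mult_op (\<lambda>x. c + \<alpha> x) = c *\<^sub>R id_blinfun + mult_op \<alpha>"
proof (rule blinfun_eqI)
  fix u
  obtain f where f: "sq_integrable f" "u = toLsq f"
    by (rule obtain_toLsq)
  have "AE x in leb01. \<bar>c + \<alpha> x\<bar> \<le> \<bar>c\<bar> + B"
    using B by eventually_elim simp
  then have "blinfun_apply (mult_op (\<lambda>x. c + \<alpha> x)) u = toLsq (\<lambda>x. c *\<^sub>R f x + \<alpha> x *\<^sub>R f x)"
    using \<alpha> f by (subst f(2), subst mult_op_toLsq) (auto simp: scaleR_add_left)
  also have "\<dots> = c *\<^sub>R u + blinfun_apply (mult_op \<alpha>) u"
    using sq_integrable_mult[OF \<alpha> B f(1)] f(1)
    by (simp add: f(2) toLsq_add toLsq_scaleR sq_integrable_scaleR mult_op_toLsq[OF \<alpha> B])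
  finally show "blinfun_apply (mult_op (\<lambda>x. c + \<alpha> x)) u = blinfun_apply (c *\<^sub>R id_blinfun + mult_op \<alpha>) u"
    by (simp add: blinfun.add_left blinfun.scaleR_left)
qed

section \<open>The coefficient sequence and its power series\<close>

text \<open>Candidate Taylor coefficients, for arbitrary \<open>B\<close> and \<open>M\<close>. The
  first two values absorb the right-hand side: the value at 1 is the one suggested by the recursion,
  \<open>M o\<^sub>L B o\<^sub>L M o\<^sub>L B\<close>, corrected by twice \<open>B\<close> from the
  linear term.\<close>

fun R_seq :: "('a::real_normed_vector \<Rightarrow>\<^sub>L 'a) \<Rightarrow> ('a \<Rightarrow>\<^sub>L 'a) \<Rightarrow> nat \<Rightarrow> 'a \<Rightarrow>\<^sub>L 'a" where
  "R_seq B M 0 = - (M o\<^sub>L B)"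
| "R_seq B M (Suc 0) = - (2 *\<^sub>R B) + (M o\<^sub>L B o\<^sub>L M o\<^sub>L B)"
| "R_seq B M (Suc (Suc n)) = - (R_seq B M n o\<^sub>L B) - (R_seq B M (Suc n) o\<^sub>L M o\<^sub>L B)"

text \<open>One constant for two purposes: it is a geometric growth rate of \<open>R_seq\<close>,
  and below its reciprocal the Neumann series converges. The summand 1 makes the powers
  nondecreasing and confines \<zeta> to the unit interval.\<close>

definition R_growth :: "('a::real_normed_vector \<Rightarrow>\<^sub>L 'a) \<Rightarrow> ('a \<Rightarrow>\<^sub>L 'a) \<Rightarrow> real" where
  "R_growth B M = 1 + norm B + norm (M o\<^sub>L B)"

lemma R_growth_ge_1: "1 \<le> R_growth B M"
  by (simp add: R_growth_def)

lemma norm_R_seq_le: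
  "norm (R_seq B M n) \<le> (norm (R_seq B M 0) + norm (R_seq B M 1)) * R_growth B M ^ n"
proof -
  define C where "C = norm (R_seq B M 0) + norm (R_seq B M 1)"
  define L where "L = R_growth B M"
  have L: "1 \<le> L" and C: "0 \<le> C"
    by (simp_all add: L_def R_growth_ge_1 C_def)
  \<comment> \<open>The recursion looks back two steps, so two consecutive bounds are carried along.
    Both predecessors are at most \<open>C * L ^ Suc n\<close>, and
    \<open>norm B + norm (M o\<^sub>L B)\<close> is \<open>L - 1\<close>.\<close>
  have "norm (R_seq B M n) \<le> C * L ^ n \<and> norm (R_seq B M (Suc n)) \<le> C * L ^ Suc n"
  proof (induction n)
    case 0
    have "norm (R_seq B M 1) \<le> C" by (simp add: C_def)
    also have "\<dots> \<le> C * L" using L C by (simp add: mult_le_cancel_left1)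
    finally show ?case by (simp add: C_def)
  next
    case (Suc n)
    have "norm (R_seq B M (Suc (Suc n))) \<le> norm (R_seq B M n o\<^sub>L B) + norm (R_seq B M (Suc n) o\<^sub>L (M o\<^sub>L B))"
      using norm_triangle_ineq4[of "- (R_seq B M n o\<^sub>L B)" "R_seq B M (Suc n) o\<^sub>L (M o\<^sub>L B)"]
      by (simp add: blinfun_compose_assoc)
    also have "\<dots> \<le> (C * L ^ Suc n) * norm B + (C * L ^ Suc n) * norm (M o\<^sub>L B)"
    proof (intro add_mono order_trans[OF norm_blinfun_compose] mult_right_mono)
      have "L ^ n \<le> L ^ Suc n" using L by (intro power_increasing) auto
      then have "C * L ^ n \<le> C * L ^ Suc n" using C by (rule mult_left_mono)
      with Suc show "norm (R_seq B M n) \<le> C * L ^ Suc n" by simp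
      show "norm (R_seq B M (Suc n)) \<le> C * L ^ Suc n" using Suc by blast
    qed auto
    also have "\<dots> = (C * L ^ Suc n) * (L - 1)"
      by (simp add: L_def R_growth_def algebra_simps)
    also have "\<dots> \<le> (C * L ^ Suc n) * L"
      using C L by (intro mult_left_mono) auto
    finally have "norm (R_seq B M (Suc (Suc n))) \<le> C * L ^ Suc (Suc n)"
      by (simp add: mult_ac)
    with Suc show ?case by blast
  qed
  then show ?thesis unfolding C_def L_def by blast
qed

lemma powser_radius_ge_R_seq:
  fixes B M :: "'a::banach \<Rightarrow>\<^sub>L 'a"
  shows "powser_radius_ge (1 / R_growth B M) (R_seq B M)"
  unfolding powser_radius_ge_def
proof (intro allI impI)
  fix x :: real
  assume x: "\<bar>x\<bar> < 1 / R_growth B M"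
  define C where "C = norm (R_seq B M 0) + norm (R_seq B M 1)"
  have L: "1 \<le> R_growth B M" by (rule R_growth_ge_1)
  have "summable (\<lambda>n. C * (R_growth B M * \<bar>x\<bar>) ^ n)"
    using x L by (intro summable_mult summable_geometric) (simp add: abs_mult field_simps)
  then show "summable (\<lambda>n. norm (R_seq B M n) * x ^ n)"
  proof (rule summable_comparison_test')
    fix n
    have "norm (R_seq B M n) * \<bar>x\<bar> ^ n \<le> (C * R_growth B M ^ n) * \<bar>x\<bar> ^ n"
      unfolding C_def by (intro mult_right_mono norm_R_seq_le) simp
    then show "norm (norm (R_seq B M n) * x ^ n) \<le> C * (R_growth B M * \<bar>x\<bar>) ^ n"
      by (simp add: abs_mult power_abs power_mult_distrib mult.assoc)
  qed
qed

text \<open>Multiplying the power series by \<open>1 + \<zeta>\<^sup>2 B + \<zeta> M B\<close> leaves only its first two terms, because the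
  recursion makes all higher coefficients of the product vanish.\<close>

lemma vec_powser_R_seq:
  fixes B M :: "'a::banach \<Rightarrow>\<^sub>L 'a"
  assumes "\<bar>\<zeta>\<bar> < 1 / R_growth B M"
  shows "vec_powser (R_seq B M) \<zeta> o\<^sub>L (id_blinfun + (\<zeta>\<^sup>2 *\<^sub>R B + \<zeta> *\<^sub>R (M o\<^sub>L B)))
    = - ((2 * \<zeta>) *\<^sub>R B + (M o\<^sub>L B))"
proof -
  define c where "c = R_seq B M"
  define X where "X = vec_powser c \<zeta>"
  define P where "P = M o\<^sub>L B"
  have X: "(\<lambda>n. \<zeta> ^ n *\<^sub>R c n) sums X"
    unfolding X_def c_def by (rule powser_radius_ge_sums[OF powser_radius_ge_R_seq assms])
  \<comment> \<open>Dropping one and two leading terms aligns the three series, so that their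
    \<open>n\<close>-th terms all carry the power \<open>n + 2\<close> of \<zeta>.\<close>
  have X1: "(\<lambda>n. \<zeta> ^ Suc n *\<^sub>R c (Suc n)) sums (X - c 0)"
    using X by (subst sums_Suc_iff[of "\<lambda>n. \<zeta> ^ n *\<^sub>R c n"]) simp
  have X2: "(\<lambda>n. \<zeta> ^ Suc (Suc n) *\<^sub>R c (Suc (Suc n))) sums (X - c 0 - \<zeta> *\<^sub>R c 1)"
    using X1 by (subst sums_Suc_iff[of "\<lambda>n. \<zeta> ^ Suc n *\<^sub>R c (Suc n)"]) simp
  have XB: "(\<lambda>n. \<zeta>\<^sup>2 *\<^sub>R ((\<zeta> ^ n *\<^sub>R c n) o\<^sub>L B)) sums (\<zeta>\<^sup>2 *\<^sub>R (X o\<^sub>L B))"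
    by (intro sums_scaleR_right bounded_linear.sums[OF blinfun_compose.bounded_linear_left X])
  have XP: "(\<lambda>n. \<zeta> *\<^sub>R ((\<zeta> ^ Suc n *\<^sub>R c (Suc n)) o\<^sub>L P)) sums (\<zeta> *\<^sub>R ((X - c 0) o\<^sub>L P))"
    by (intro sums_scaleR_right bounded_linear.sums[OF blinfun_compose.bounded_linear_left X1])
  have rec: "c (Suc (Suc n)) = - (c n o\<^sub>L B) - (c (Suc n) o\<^sub>L P)" for n
    by (simp add: c_def P_def blinfun_compose_assoc)
  have zero: "\<zeta> ^ Suc (Suc n) *\<^sub>R c (Suc (Suc n)) + \<zeta>\<^sup>2 *\<^sub>R ((\<zeta> ^ n *\<^sub>R c n) o\<^sub>L B)
      + \<zeta> *\<^sub>R ((\<zeta> ^ Suc n *\<^sub>R c (Suc n)) o\<^sub>L P) = 0" for n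
    by (simp add: rec blinfun_compose_algebra scaleR_diff_right power2_eq_square mult.assoc)
  have "(\<lambda>n. 0) sums (X - c 0 - \<zeta> *\<^sub>R c 1 + \<zeta>\<^sup>2 *\<^sub>R (X o\<^sub>L B) + \<zeta> *\<^sub>R ((X - c 0) o\<^sub>L P))"
    using sums_add[OF sums_add[OF X2 XB] XP] unfolding zero .
  then have "X - c 0 - \<zeta> *\<^sub>R c 1 + \<zeta>\<^sup>2 *\<^sub>R (X o\<^sub>L B) + \<zeta> *\<^sub>R ((X - c 0) o\<^sub>L P) = 0"
    using sums_unique2 sums_zero by blast
  then have "X o\<^sub>L (id_blinfun + (\<zeta>\<^sup>2 *\<^sub>R B + \<zeta> *\<^sub>R P)) = c 0 + \<zeta> *\<^sub>R (c 1 + (c 0 o\<^sub>L P))"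
    by (simp add: blinfun_compose_algebra algebra_simps)
  also have "\<dots> = - ((2 * \<zeta>) *\<^sub>R B + P)"
    by (simp add: c_def P_def blinfun_compose_algebra blinfun_compose_assoc algebra_simps)
  finally show ?thesis
    by (simp add: X_def c_def P_def)
qed

lemma resolvent_expansion:
  assumes B: "is_bounded_inverse B (TstarT K)"
    and \<alpha>: "\<alpha> \<in> borel_measurable leb01" and bound: "AE x in leb01. \<bar>\<alpha> x\<bar> \<le> b"
    and \<zeta>: "\<bar>\<zeta>\<bar> < 1 / R_growth B (mult_op \<alpha>)"
  shows "boundedly_invertible (pencil K \<alpha> \<zeta>)"
    and "R K \<alpha> \<zeta> = vec_powser (R_seq B (mult_op \<alpha>)) \<zeta>"
proof -
  define M where "M = mult_op \<alpha>"
  define T where "T = \<zeta>\<^sup>2 *\<^sub>R B + \<zeta> *\<^sub>R (M o\<^sub>L B)"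
  have L: "1 \<le> R_growth B M" "\<bar>\<zeta>\<bar> * R_growth B M < 1"
    using R_growth_ge_1[of B M] \<zeta> by (simp_all add: M_def field_simps)
  have "\<bar>\<zeta>\<bar> \<le> \<bar>\<zeta>\<bar> * R_growth B M"
    using L(1) by (simp add: mult_le_cancel_left1)
  \<comment> \<open>This lets the quadratic term of \<open>T\<close> be estimated by the linear one,
    so that \<open>R_growth\<close> controls both.\<close>
  with L(2) have "\<bar>\<zeta>\<bar> \<le> 1" by linarith
  then have "\<zeta>\<^sup>2 \<le> \<bar>\<zeta>\<bar>"
    using mult_left_le[of "\<bar>\<zeta>\<bar>" "\<bar>\<zeta>\<bar>"] by (simp add: power2_eq_square flip: abs_mult)
  then have "norm T \<le> \<bar>\<zeta>\<bar> * norm B + \<bar>\<zeta>\<bar> * norm (M o\<^sub>L B)"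
    unfolding T_def by (intro order_trans[OF norm_triangle_ineq] add_mono) (auto intro: mult_right_mono)
  also have "\<dots> \<le> \<bar>\<zeta>\<bar> * R_growth B M"
    by (simp add: R_growth_def algebra_simps)
  finally have "norm T < 1"
    using L(2) by simp
  then obtain S where S: "(id_blinfun + T) o\<^sub>L S = id_blinfun" "S o\<^sub>L (id_blinfun + T) = id_blinfun"
    by (rule Neumann_inverse)
  have inv: "is_bounded_inverse (B o\<^sub>L S) (pencil K \<alpha> \<zeta>)"
    using B S by (rule is_bounded_inverse_pencil) (simp add: T_def M_def)
  then show "boundedly_invertible (pencil K \<alpha> \<zeta>)"
    by (auto simp: boundedly_invertible_def)
  have "R K \<alpha> \<zeta> = - (((2 * \<zeta>) *\<^sub>R id_blinfun + M) o\<^sub>L (B o\<^sub>L S))"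
    by (simp add: R_def Q_def inverse_op_eq[OF inv] mult_op_shift[OF \<alpha> bound] M_def)
  also have "\<dots> = - ((2 * \<zeta>) *\<^sub>R B + (M o\<^sub>L B)) o\<^sub>L S"
    by (simp add: blinfun_compose_algebra blinfun_compose_assoc)
  \<comment> \<open>The numerator is traded for the power series times
    \<open>id_blinfun + T\<close>, a factor that \<open>S\<close> then cancels.\<close>
  also have "\<dots> = vec_powser (R_seq B M) \<zeta> o\<^sub>L (id_blinfun + T) o\<^sub>L S"
    using vec_powser_R_seq[of \<zeta> B M] \<zeta> by (simp add: M_def T_def)
  also have "\<dots> = vec_powser (R_seq B M) \<zeta>"
    by (simp add: blinfun_compose_assoc S)
  finally show "R K \<alpha> \<zeta> = vec_powser (R_seq B (mult_op \<alpha>)) \<zeta>"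
    by (simp add: M_def)
qed

theorem proposition2p5:
  fixes K :: realization and \<alpha> :: "real \<Rightarrow> real" and a b :: real
  assumes "admissible K"
    and "\<alpha> \<in> borel_measurable (lebesgue_on {0<..<1})"
    and "0 \<le> 2 * a"
    and "AE x in lebesgue_on {0<..<1}. 2 * a \<le> \<alpha> x \<and> \<alpha> x \<le> 2 * b"
  shows "boundedly_invertible (TstarT K) \<and>
    (\<exists>\<epsilon>>0. \<forall>\<zeta>. \<bar>\<zeta>\<bar> < \<epsilon> \<longrightarrow>
       boundedly_invertible (pencil K \<alpha> \<zeta>) \<and>
       (\<forall>n. nth_vector_derivative n (R K \<alpha>) differentiable (at \<zeta>))) \<and>
    (\<forall>n\<ge>2. R_coeff n K \<alpha> =
       - (R_coeff (n - 2) K \<alpha> o\<^sub>L inverse_op (TstarT K))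
       - (R_coeff (n - 1) K \<alpha> o\<^sub>L mult_op \<alpha> o\<^sub>L inverse_op (TstarT K))) \<and>
    R_coeff 0 K \<alpha> = R K \<alpha> 0 \<and>
    R K \<alpha> 0 = - (mult_op \<alpha> o\<^sub>L inverse_op (TstarT K)) \<and>
    R_coeff 1 K \<alpha> = vector_derivative (R K \<alpha>) (at 0) \<and>
    vector_derivative (R K \<alpha>) (at 0) =
       - (2 *\<^sub>R inverse_op (TstarT K))
       + (mult_op \<alpha> o\<^sub>L inverse_op (TstarT K) o\<^sub>L mult_op \<alpha> o\<^sub>L inverse_op (TstarT K))"
proof -
  have invertible: "boundedly_invertible (TstarT K)"
    by (rule boundedly_invertible_TstarT[OF assms(1)])
  then obtain B where B: "is_bounded_inverse B (TstarT K)"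
    by (auto simp: boundedly_invertible_def)
  have BI: "inverse_op (TstarT K) = B"
    by (rule inverse_op_eq[OF B])
  define M where "M = mult_op \<alpha>"
  define r where "r = 1 / R_growth B M"
  have r: "0 < r"
    using R_growth_ge_1[of B M] by (simp add: r_def)
  \<comment> \<open>The lower bound makes \<alpha> nonnegative a.e., so its upper bound also bounds
    its modulus.\<close>
  have bound: "AE x in leb01. \<bar>\<alpha> x\<bar> \<le> 2 * b"
    using assms(4) by eventually_elim (use assms(3) in linarith)
  have exp: "boundedly_invertible (pencil K \<alpha> \<zeta>)" "R K \<alpha> \<zeta> = vec_powser (R_seq B M) \<zeta>"
    if "\<bar>\<zeta>\<bar> < r" for \<zeta>
    using resolvent_expansion[OF B assms(2) bound] that unfolding r_def M_def by blast+
  note rad = powser_radius_ge_R_seq[of B M, folded r_def]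
  have diff: "nth_vector_derivative n (R K \<alpha>) differentiable (at \<zeta>)" if "\<bar>\<zeta>\<bar> < r" for n \<zeta>
    by (rule differentiableI_vector, rule nth_vector_derivative_vec_powser(2)[OF rad exp(2) that])
  have der: "nth_vector_derivative n (R K \<alpha>) 0 = fact n *\<^sub>R R_seq B M n" for n
    by (rule nth_vector_derivative_vec_powser_0[OF rad exp(2) r])
  have coeff: "R_coeff n K \<alpha> = R_seq B M n" for n
    by (simp add: R_coeff_def der)
  have R0: "R K \<alpha> 0 = R_seq B M 0"
    using der[of 0] by (simp add: nth_vector_derivative_def)
  have R1: "vector_derivative (R K \<alpha>) (at 0) = R_seq B M 1"
    using der[of 1] by (simp add: nth_vector_derivative_def)
  have "R_coeff n K \<alpha> = - (R_coeff (n - 2) K \<alpha> o\<^sub>L B) - (R_coeff (n - 1) K \<alpha> o\<^sub>L M o\<^sub>L B)"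
    if n: "2 \<le> n" for n
  proof -
    obtain k where "n = Suc (Suc k)"
      using n by (metis Suc_le_D numeral_2_eq_2 Suc_le_mono)
    then show ?thesis by (simp add: coeff)
  qed
  then show ?thesis
    unfolding BI M_def[symmetric]
    using invertible exp(1) diff r R0 R1 by (auto simp: coeff)
qed

end
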